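(* Suppose that $R$ is a principal ideal domain. Let $\mathcal{S}_1$ be a set of representatives, up to multiplication by units of $R$, of the couples $(c,d)\in R^2$ satisfying $$c\neq 0,\quad cR+dR=R,\quad |N(c)|\le \frac{2k}{k_0^2},$$ $$\left|\frac{d}{c}\right|<\epsilon_0\sqrt{\frac{2k}{N(c)^2k_0^2}-\frac{k_0^2}{2k}}+\frac{1+\omega}{2}\quad\text{and}\quad \left|\frac{d'}{c'}\right|<\epsilon_0\sqrt{\frac{2k}{N(c)^2k_0^2}-\frac{k_0^2}{2k}}+\frac{1-\omega'}{2}.$$ For each $(c,d)\in\mathcal{S}_1$ choose $a,b\in R$ such that $P_{c,d}=\begin{pmatrix}a&b\\c&d\end{pmatrix}\in\Gamma$. Then $$\Gamma=\langle P_1,P_2,P_3,P_{c,d}\mid (c,d)\in\mathcal{S}_1\rangle,$$ i.e. $\Gamma$ is generated by these elements.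
   Context: Let $k>1$ be a square-free integer; $k_0=1$ if $k\not\equiv 1 \pmod 4$ and $k_0=2$ if $k\equiv 1\pmod 4$; $\omega=\frac{1+\sqrt{k}}{k_0}$; $R=\mathbb{Z}[\omega]$ is the ring of integers of $K=\mathbb{Q}(\sqrt k)$. For $\alpha\in K$, $\alpha'$ is its algebraic conjugate and $N(\alpha)=\alpha\alpha'$. $\epsilon_0$ is the fundamental unit, i.e. the smallest unit of $R$ greater than $1$. "Up to multiplication by units" means that $(c,d)$ and $(uc,ud)$ are identified for every unit $u\in R$. $\Gamma=\mathrm{PSL}_2(R)$; its elements are denoted by representing matrices in $\mathrm{SL}_2(R)$. Put $$P_1=\begin{pmatrix}1&1\\0&1\end{pmatrix},\quad P_2=\begin{pmatrix}1&\omega\\0&1\end{pmatrix},\quad P_3=\begin{pmatrix}\epsilon_0&0\\0&\epsilon_0^{-1}\end{pmatrix}.$$ *)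

theory Defs
  imports
    "HOL-Analysis.Analysis"
    "HOL-Computational_Algebra.Computational_Algebra"
    "HOL-Algebra.Generated_Groups"
    "HOL-Algebra.Ring_Divisibility"
begin

text \<open>The real quadratic field of \<open>k\<close> is taken inside the reals, with the positive square root.\<close>

definition k0 :: "int \<Rightarrow> real" where
  "k0 k = (if k mod 4 = 1 then 2 else 1)"

definition omega :: "int \<Rightarrow> real" where
  "omega k = (1 + sqrt (of_int k)) / k0 k"

text \<open>Only meaningful on the field itself; well defined there because \<open>sqrt k\<close> is irrational
  for squarefree \<open>k > 1\<close> (see \<open>quad_conj_eq\<close>).\<close>

definition quad_conj :: "int \<Rightarrow> real \<Rightarrow> real" where
  "quad_conj k \<alpha> = (THE \<beta>. \<exists>x\<in>\<rat>. \<exists>y\<in>\<rat>.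
     \<alpha> = x + y * sqrt (of_int k) \<and> \<beta> = x - y * sqrt (of_int k))"

definition quad_norm :: "int \<Rightarrow> real \<Rightarrow> real" where
  "quad_norm k \<alpha> = \<alpha> * quad_conj k \<alpha>"

text \<open>The ring \<open>\<int>[\<omega>]\<close>.\<close>

definition quad_ring :: "int \<Rightarrow> real ring" where
  "quad_ring k =
     \<lparr>carrier = {poly (map_poly of_int p) (omega k) | p :: int poly. True},
      mult = (*), one = 1, zero = 0, add = (+)\<rparr>"

definition fund_unit :: "int \<Rightarrow> real" where
  "fund_unit k = (LEAST u. u \<in> Units (quad_ring k) \<and> 1 < u)"

definition mat2 :: "real \<Rightarrow> real \<Rightarrow> real \<Rightarrow> real \<Rightarrow> real^2^2" where
  "mat2 a b c d = vector [vector [a, b], vector [c, d]]"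

definition SL2 :: "int \<Rightarrow> (real^2^2) monoid" where
  "SL2 k = \<lparr>carrier = {A. (\<forall>i j. A $ i $ j \<in> carrier (quad_ring k)) \<and> det A = 1},
            mult = (**), one = mat 1\<rparr>"

definition PSL2 :: "int \<Rightarrow> (real^2^2) set monoid" where
  "PSL2 k = SL2 k Mod {mat 1, - mat 1}"

text \<open>The element of \<open>PSL2 k\<close> represented by a matrix of \<open>SL2 k\<close>.\<close>

definition PSL2_class :: "int \<Rightarrow> real^2^2 \<Rightarrow> (real^2^2) set" where
  "PSL2_class k A = {mat 1, - mat 1} #>\<^bsub>SL2 k\<^esub> A"

definition P1 :: "real^2^2" where
  "P1 = mat2 1 1 0 1"

definition P2 :: "int \<Rightarrow> real^2^2" where
  "P2 k = mat2 1 (omega k) 0 1"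

definition P3 :: "int \<Rightarrow> real^2^2" where
  "P3 k = mat2 (fund_unit k) 0 0 (inverse (fund_unit k))"

definition bound_sqrt :: "int \<Rightarrow> real \<Rightarrow> real" where
  "bound_sqrt k c = sqrt (2 * of_int k / ((quad_norm k c)\<^sup>2 * (k0 k)\<^sup>2) - (k0 k)\<^sup>2 / (2 * of_int k))"

definition couples :: "int \<Rightarrow> (real \<times> real) set" where
  "couples k = {(c, d). c \<in> carrier (quad_ring k) \<and> d \<in> carrier (quad_ring k) \<and> c \<noteq> 0 \<and>
     PIdl\<^bsub>quad_ring k\<^esub> c <+>\<^bsub>quad_ring k\<^esub> PIdl\<^bsub>quad_ring k\<^esub> d = carrier (quad_ring k) \<and>
     \<bar>quad_norm k c\<bar> \<le> 2 * of_int k / (k0 k)\<^sup>2 \<and>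
     \<bar>d / c\<bar> < fund_unit k * bound_sqrt k c + (1 + omega k) / 2 \<and>
     \<bar>quad_conj k d / quad_conj k c\<bar> < fund_unit k * bound_sqrt k c + (1 - quad_conj k (omega k)) / 2}"

definition representatives_up_to_units :: "int \<Rightarrow> (real \<times> real) set \<Rightarrow> (real \<times> real) set \<Rightarrow> bool" where
  "representatives_up_to_units k C S \<longleftrightarrow> S \<subseteq> C \<and>
     (\<forall>(c, d)\<in>C. \<exists>!s. s \<in> S \<and> (\<exists>u\<in>Units (quad_ring k). s = (u * c, u * d)))"

lemma omega_sq:
  assumes "k > 1"
  shows "omega k * omega k = (if k mod 4 = 1 then of_int ((k - 1) div 4) + omega k
                              else of_int (k - 1) + 2 * omega k)"
proof (cases "k mod 4 = 1")
  case True
  then have "4 * ((k - 1) div 4) = k - 1" by presburger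
  then have "of_int (4 * ((k - 1) div 4)) = (of_int (k - 1) :: real)" by (rule arg_cong)
  then have "of_int ((k - 1) div 4) = (of_int k - 1) / (4::real)" by simp
  then show ?thesis using True assms
    by (simp add: omega_def k0_def field_simps)
next
  case False
  then show ?thesis using assms by (simp add: omega_def k0_def field_simps)
qed

lemma carrier_quad_ring:
  assumes "k > 1"
  shows "carrier (quad_ring k) = {of_int x + of_int y * omega k | x y. True}"
proof -
  define t :: int where "t = (if k mod 4 = 1 then 1 else 2)"
  define n :: int where "n = (if k mod 4 = 1 then (k - 1) div 4 else k - 1)"
  have sq: "omega k * omega k = of_int n + of_int t * omega k"
    using omega_sq[OF assms] by (auto simp: t_def n_def)
  have "\<exists>x y. poly (map_poly of_int p) (omega k) = of_int x + of_int y * omega k" for p :: "int poly"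
  proof (induction p)
    case 0
    show ?case by (rule exI[of _ 0], rule exI[of _ 0]) simp
  next
    case (pCons a p)
    then obtain x y where xy: "poly (map_poly of_int p) (omega k) = of_int x + of_int y * omega k"
      by blast
    have "poly (map_poly of_int (pCons a p)) (omega k)
        = of_int a + omega k * poly (map_poly of_int p) (omega k)"
      using pCons.hyps by (simp add: map_poly_pCons)
    also have "\<dots> = of_int a + of_int x * omega k + of_int y * (omega k * omega k)"
      unfolding xy by (simp add: algebra_simps)
    also have "\<dots> = of_int (a + y * n) + of_int (x + y * t) * omega k"
      unfolding sq by (simp add: algebra_simps)
    finally show ?case by blast
  qed
  moreover have "\<exists>p :: int poly. of_int x + of_int y * omega k = poly (map_poly of_int p) (omega k)"
    for x y
    by (rule exI[of _ "[:x, y:]"]) (simp add: map_poly_pCons)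
  ultimately show ?thesis
    by (auto simp: quad_ring_def)
qed

lemma sqrt_irrational:
  assumes "squarefree k" "k > (1::int)"
  shows "sqrt (of_int k) \<notin> \<rat>"
proof
  assume "sqrt (of_int k) \<in> \<rat>"
  then obtain m n :: nat where mn: "n \<noteq> 0" "\<bar>sqrt (of_int k)\<bar> = real m / real n" "coprime m n"
    by (rule Rats_abs_nat_div_natE)
  then have "real m = sqrt (of_int k) * real n"
    using assms(2) by (simp add: field_simps)
  then have "(real m)\<^sup>2 = of_int k * (real n)\<^sup>2"
    using assms(2) by (simp add: power_mult_distrib)
  then have "of_int ((int m)\<^sup>2) = (of_int (k * (int n)\<^sup>2) :: real)" by simp
  then have eq: "(int m)\<^sup>2 = k * (int n)\<^sup>2" by (simp only: of_int_eq_iff)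
  then have "(int n)\<^sup>2 dvd (int m)\<^sup>2" by simp
  then have "int n dvd int m" by simp
  then have "is_unit (int n)" using mn(3)
    by (metis coprime_common_divisor coprime_int_iff dvd_refl)
  then have "k = (int m)\<^sup>2" using eq by simp
  then show False using assms
    by (metis dvd_refl squarefree_def is_unit_power_iff zdvd1_eq abs_of_pos less_le_trans zero_less_one less_imp_le less_irrefl)
qed

lemma quad_conj_eq:
  assumes "squarefree k" "k > 1" "x \<in> \<rat>" "y \<in> \<rat>"
  shows "quad_conj k (x + y * sqrt (of_int k)) = x - y * sqrt (of_int k)"
  unfolding quad_conj_def
proof (rule the_equality)
  fix \<beta>
  assume "\<exists>x'\<in>\<rat>. \<exists>y'\<in>\<rat>. x + y * sqrt (of_int k) = x' + y' * sqrt (of_int k) \<and>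
            \<beta> = x' - y' * sqrt (of_int k)"
  then obtain x' y' where *: "x' \<in> \<rat>" "y' \<in> \<rat>"
      "x + y * sqrt (of_int k) = x' + y' * sqrt (of_int k)" "\<beta> = x' - y' * sqrt (of_int k)"
    by blast
  have "y = y'"
  proof (rule ccontr)
    assume "y \<noteq> y'"
    then have "sqrt (of_int k) = (x' - x) / (y - y')" using *(3) by (simp add: field_simps)
    moreover have "(x' - x) / (y - y') \<in> \<rat>" using *(1,2) assms(3,4) by simp
    ultimately show False using sqrt_irrational[OF assms(1,2)] by simp
  qed
  then show "\<beta> = x - y * sqrt (of_int k)" using *(3,4) by simp
qed (use assms in blast)

lemma quad_ring_closed:
  assumes "x \<in> carrier (quad_ring k)" "y \<in> carrier (quad_ring k)"
  shows "x + y \<in> carrier (quad_ring k)" "x * y \<in> carrier (quad_ring k)"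
    "- x \<in> carrier (quad_ring k)"
proof -
  obtain p q :: "int poly" where *: "x = poly (map_poly of_int p) (omega k)"
      "y = poly (map_poly of_int q) (omega k)"
    using assms by (auto simp: quad_ring_def)
  have "map_poly of_int (p + q) = (map_poly of_int p + map_poly of_int q :: real poly)"
    by (rule poly_eqI) (simp add: coeff_map_poly)
  moreover have "map_poly of_int (p * q) = (map_poly of_int p * map_poly of_int q :: real poly)"
    by (rule poly_eqI) (simp add: coeff_map_poly coeff_mult)
  moreover have "map_poly of_int (- p) = (- map_poly of_int p :: real poly)"
    by (rule poly_eqI) (simp add: coeff_map_poly)
  ultimately have "x + y = poly (map_poly of_int (p + q)) (omega k)"
    "x * y = poly (map_poly of_int (p * q)) (omega k)"
    "- x = poly (map_poly of_int (- p)) (omega k)"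
    using * by simp_all
  then show "x + y \<in> carrier (quad_ring k)" "x * y \<in> carrier (quad_ring k)"
    "- x \<in> carrier (quad_ring k)"
    unfolding quad_ring_def by auto
qed

lemma quad_ring_0_1: "0 \<in> carrier (quad_ring k)" "1 \<in> carrier (quad_ring k)"
  unfolding quad_ring_def by (auto intro: exI[of _ "0 :: int poly"] exI[of _ "1 :: int poly"])

lemma group_SL2: "group (SL2 k)"
proof (rule groupI)
  fix A B assume "A \<in> carrier (SL2 k)" "B \<in> carrier (SL2 k)"
  then show "A \<otimes>\<^bsub>SL2 k\<^esub> B \<in> carrier (SL2 k)"
    using det_mul[of A B]
    by (auto simp: SL2_def matrix_matrix_mult_def sum_2 intro!: quad_ring_closed)
next
  show "\<one>\<^bsub>SL2 k\<^esub> \<in> carrier (SL2 k)"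
    using det_I[where 'n = 2 and 'a = real]
    by (auto simp: SL2_def mat_def quad_ring_0_1)
next
  fix A assume A: "A \<in> carrier (SL2 k)"
  define B where "B = mat2 (A $ 2 $ 2) (- (A $ 1 $ 2)) (- (A $ 2 $ 1)) (A $ 1 $ 1)"
  have "B \<in> carrier (SL2 k)" "B ** A = mat 1"
    using A by (auto simp: SL2_def B_def mat2_def det_2 forall_2 quad_ring_closed
        vec_eq_iff matrix_matrix_mult_def sum_2 mat_def algebra_simps)
  then show "\<exists>B\<in>carrier (SL2 k). B \<otimes>\<^bsub>SL2 k\<^esub> A = \<one>\<^bsub>SL2 k\<^esub>"
    by (auto simp: SL2_def)
qed (auto simp: SL2_def matrix_mul_assoc)

lemma normal_center: "{mat 1, - mat 1} \<lhd> SL2 k"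
proof -
  interpret group "SL2 k" by (rule group_SL2)
  have neg: "(- mat 1) ** A = - A" "A ** (- mat 1) = - A" for A :: "real^2^2"
    by (simp_all add: vec_eq_iff matrix_matrix_mult_def mat_def sum_2 forall_2)
  have mem: "- mat 1 \<in> carrier (SL2 k)"
    using quad_ring_closed(3)[OF quad_ring_0_1(2) quad_ring_0_1(2), of k]
    by (auto simp: SL2_def mat_def det_2 quad_ring_0_1)
  have inv: "inv\<^bsub>SL2 k\<^esub> (- mat 1) = - mat 1"
    by (rule inv_equality) (use mem neg in \<open>auto simp: SL2_def\<close>)
  have one: "\<one>\<^bsub>SL2 k\<^esub> = mat 1" by (simp add: SL2_def)
  have mult: "A \<otimes>\<^bsub>SL2 k\<^esub> B = A ** B" for A B by (simp add: SL2_def)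
  have "subgroup {mat 1, - mat 1} (SL2 k)"
    by (rule subgroupI) (use mem inv one one_closed inv_one in \<open>auto simp: mult neg\<close>)
  moreover have "{mat 1, - mat 1} #>\<^bsub>SL2 k\<^esub> A = A <#\<^bsub>SL2 k\<^esub> {mat 1, - mat 1}" for A
    by (auto simp: r_coset_def l_coset_def mult neg)
  ultimately show ?thesis
    by (intro normalI) auto
qed

end

theory Submission
  imports Defs
begin

text \<open>Call the bottom rows \<open>(c, d)\<close> of matrices in \<open>SL2 k\<close> cusps.  The group acts on them
  transitively by right multiplication, and the stabiliser of the cusp \<open>(0, 1)\<close> up to units, the
  group of upper triangular matrices, is generated by \<open>P1\<close>, \<open>P2\<close>, \<open>P3\<close> and \<open>-1\<close>.  So a subgroup
  \<open>H\<close> that contains these matrices is the whole group as soon as it moves \<open>(0, 1)\<close> to every cusp.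

  To move between cusps, measure them.  A pair \<open>(f, g)\<close> of positive definite binary quadratic forms
  gives a cusp the norm \<open>f c d * g c' d'\<close>, primes denoting conjugates.  Up to scaling, each of the two
  forms is \<open>\<bar>c z + d\<bar>\<^sup>2\<close> for a point \<open>z\<close> of the upper half plane, so that the norm is proportional to
  \<open>\<bar>c z1 + d\<bar>\<^sup>2 \<bar>c' z2 + d'\<bar>\<^sup>2\<close>.  Working with forms instead of points makes the space
  convex.  Given a cusp \<open>v\<close>, take a pair for which \<open>(0, 1)\<close> has minimal norm, one for which \<open>v\<close> has
  minimal norm, and the segment between them.  Finitely many cusps up to units compete along the
  segment (\<open>finite_bounded_cusps_mod_units\<close>), so the parameters at which some cusp of the \<open>H\<close>-orbit of
  \<open>(0, 1)\<close> is minimal form a closed set, and so do those at which a cusp outside the orbit is minimal.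
  Since an interval is connected, \<open>v\<close> can lie outside the orbit only if at some parameter both kinds of
  cusp are minimal at once.

  This is impossible by \<open>minimal_neighbour_in_orb\<close>.  Moving by \<open>H\<close>, let \<open>(0, 1)\<close> and \<open>(c, d)\<close> be
  minimal at \<open>(z1, z2)\<close>, with \<open>c \<noteq> 0\<close>.  As \<open>R\<close> is a principal ideal domain, every nonzero pair in
  \<open>R \<times> R\<close> is a multiple of a cusp, so \<open>\<bar>n z1 + d\<bar> \<bar>n z2 + d'\<bar> \<ge> 1\<close> for all integers \<open>n\<close> and all \<open>d\<close>
  in \<open>R\<close> that are not both zero.  The pairs \<open>(n, d)\<close> form a lattice of rank three, and Hermite's
  constant in dimension three yields \<open>y1 y2 \<ge> k0\<^sup>2 / (2 k)\<close> for the imaginary parts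
  (\<open>height_lower_bound\<close>).  Together
  with \<open>\<bar>c z1 + d\<bar> \<bar>c' z2 + d'\<bar> = 1\<close> this bounds the norm of \<open>c\<close> and the distances of the real parts
  of \<open>z1\<close>, \<open>z2\<close> from \<open>- d / c\<close>, \<open>- d' / c'\<close>.  A power of the fundamental unit makes \<open>y1 / y2\<close> lie
  between the inverse square and the square of that unit, and a translation brings the real parts
  into the cell spanned by \<open>1\<close> and \<open>\<omega>\<close>; the moved \<open>(c, d)\<close> then belongs to \<open>couples k\<close>, so that one of
  the generators moves \<open>(0, 1)\<close> to it, up to a unit.\<close>

section \<open>Hermite's constant in dimension three\<close>

text \<open>The inequality \<open>a b c \<le> 2 det\<close> of Gauss and Seeber for a Minkowski reduced Gram matrix
  with diagonal \<open>a\<close>, \<open>b\<close>, \<open>c\<close> and inner products \<open>f\<close>, \<open>g\<close>, \<open>h\<close>. What has to be bounded is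
  convex in each of \<open>f\<close>, \<open>g\<close>, \<open>h\<close> and along the edges of the polytope that the reduction
  inequalities cut out, hence largest at a vertex; the case distinctions move the variables
  towards the vertices. For \<open>f \<ge> 0\<close> the polytope is a box, for \<open>f < 0\<close> the last inequality
  cuts off one of its corners.\<close>

lemma reduced_gram_det:
  fixes a b c f g h :: real
  assumes "0 < a" "a \<le> b" "b \<le> c"
    and g: "0 \<le> g" "2 * g \<le> a" and h: "0 \<le> h" "2 * h \<le> a"
    and f: "\<bar>2 * f\<bar> \<le> b" and obtuse: "2 * g + 2 * h - 2 * f \<le> a + b"
  shows "a * b * c \<le> 2 * (a * b * c + 2 * f * g * h - a * f\<^sup>2 - b * g\<^sup>2 - c * h\<^sup>2)"
proof -
  have ab: "a * b\<^sup>2 \<le> a * b * c" "a\<^sup>2 * c \<le> a * b * c" "a\<^sup>2 * b \<le> a * b * c"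
    using assms by (auto simp: power2_eq_square mult_mono mult_left_mono mult_right_mono)
  have g2: "4 * g\<^sup>2 \<le> a\<^sup>2" and h2: "4 * h\<^sup>2 \<le> a\<^sup>2"
    using power_mono[of "2 * g" a 2] power_mono[of "2 * h" a 2] g h by (auto simp: power_mult_distrib)
  have bg: "4 * (b * g\<^sup>2) \<le> a\<^sup>2 * b" and ch: "4 * (c * h\<^sup>2) \<le> a\<^sup>2 * c"
    using mult_left_mono[OF g2, of b] mult_left_mono[OF h2, of c] assms by (auto simp: algebra_simps)
  have key: "a * f\<^sup>2 + b * g\<^sup>2 + c * h\<^sup>2 - 2 * f * g * h \<le> a * b * c / 2"
  proof (cases "0 \<le> f")
    case True
    have fb: "2 * f \<le> b" using f by simp
    show ?thesis
    proof (cases "a * f \<le> 2 * g * h")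
      case True
      then have "f * (a * f - 2 * g * h) \<le> 0" using \<open>0 \<le> f\<close> by (simp add: mult_nonneg_nonpos)
      then have "a * f\<^sup>2 - 2 * f * g * h \<le> 0" by (simp add: power2_eq_square algebra_simps)
      then show ?thesis using bg ch ab by linarith
    next
      case False
      (* Push f to b / 2 and, in the last case below, also g to a / 2. *)
      have "f * (a * f - 2 * g * h) \<le> b / 2 * (a * (b / 2) - 2 * g * h)"
        using False fb \<open>0 \<le> f\<close> assms by (intro mult_mono) (auto simp: mult_left_mono)
      then have 1: "a * f\<^sup>2 - 2 * f * g * h \<le> a * b\<^sup>2 / 4 - b * g * h"
        by (simp add: power2_eq_square algebra_simps)
      show ?thesis
      proof (cases "g \<le> h")
        case True
        then have "b * g * (g - h) \<le> 0" using assms by (simp add: mult_nonneg_nonpos)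
        then have "b * g\<^sup>2 - b * g * h \<le> 0" by (simp add: power2_eq_square algebra_simps)
        then show ?thesis using 1 ch ab by linarith
      next
        case False
        have "b * (g * (g - h)) \<le> b * (a / 2 * (a / 2 - h))"
          using False assms by (intro mult_left_mono mult_mono) auto
        then have 2: "b * g\<^sup>2 - b * g * h \<le> a\<^sup>2 * b / 4 - a * b * h / 2"
          by (simp add: power2_eq_square algebra_simps)
        have "b * h * (2 * h) \<le> b * h * a" using assms by (intro mult_left_mono) auto
        moreover have "(c - b) * (4 * h\<^sup>2) \<le> (c - b) * a\<^sup>2" using h2 assms by (intro mult_left_mono) auto
        ultimately have "c * h\<^sup>2 \<le> a * b * h / 2 + a\<^sup>2 * c / 4 - a\<^sup>2 * b / 4"
          by (simp add: power2_eq_square algebra_simps)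
        then show ?thesis using 1 2 ab by linarith
      qed
    qed
  next
    case False
    define e where "e = - f"
    have e: "0 \<le> e" "2 * e \<le> b" "2 * (e + g + h) \<le> a + b" using False f obtuse by (auto simp: e_def)
    have gh: "0 \<le> g * h" using g h by simp
    have goal: "a * e\<^sup>2 + b * g\<^sup>2 + c * h\<^sup>2 + 2 * e * g * h \<le> a * b * c / 2"
    proof (cases "2 * (g + h) \<le> a")
      case True
      have "4 * e\<^sup>2 \<le> b\<^sup>2" using power_mono[of "2 * e" b 2] e by (auto simp: power_mult_distrib)
      then have 1: "a * e\<^sup>2 \<le> a * b\<^sup>2 / 4" using mult_left_mono[of "4 * e\<^sup>2" "b\<^sup>2" a] assms by simp
      have "(2 * (g + h))\<^sup>2 \<le> a\<^sup>2" using True g h by (intro power_mono) auto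
      then have "4 * (g + h)\<^sup>2 \<le> a\<^sup>2" unfolding power_mult_distrib by simp
      then have 2: "c * (g + h)\<^sup>2 \<le> a\<^sup>2 * c / 4"
        using mult_left_mono[of "4 * (g + h)\<^sup>2" "a\<^sup>2" c] assms by (simp add: algebra_simps)
      have 3: "2 * e * (g * h) \<le> 2 * c * (g * h)" using e gh assms by (intro mult_right_mono) auto
      have 4: "b * g\<^sup>2 \<le> c * g\<^sup>2" using assms by (intro mult_right_mono) auto
      have "c * (g + h)\<^sup>2 = c * g\<^sup>2 + c * h\<^sup>2 + 2 * c * (g * h)"
        by (simp add: power2_eq_square algebra_simps)
      then show ?thesis using 1 2 3 4 ab by (simp add: algebra_simps)
    next
      case False
      (* Here f = -e is limited by the cut-off corner: e is at most e0. At e = e0 the worst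
         case for given S = g + h has the smallest product g h, which is T. What is left is
         a convex quadratic in S with equal values at S = a / 2 and S = a; it lies below
         them by U. *)
      define S where "S = g + h"
      define e0 where "e0 = (a + b) / 2 - S"
      have S: "a / 2 \<le> S" "S \<le> a" using False g h by (auto simp: S_def)
      have e0: "e \<le> e0" "0 \<le> e0" "e0 \<le> b / 2" using e(3) S(1,2) assms(2) unfolding e0_def S_def by (simp_all add: field_simps)
      have "(a / 2 - g) * (a / 2 - h) \<ge> 0" using g h by (intro mult_nonneg_nonneg) auto
      define T where "T = a * S / 2 - a\<^sup>2 / 4"
      have P: "T \<le> g * h" using \<open>(a / 2 - g) * (a / 2 - h) \<ge> 0\<close>
        by (simp add: T_def S_def power2_eq_square field_simps)
      have 1: "a * e\<^sup>2 \<le> a * e0\<^sup>2" using e0 e assms by (intro mult_left_mono power_mono) auto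
      have 2: "e * (g * h) \<le> e0 * (g * h)" using e0 gh by (intro mult_right_mono) auto
      have "(c - b) * (4 * h\<^sup>2) \<le> (c - b) * a\<^sup>2" using h2 assms by (intro mult_left_mono) auto
      then have 3: "c * h\<^sup>2 \<le> b * h\<^sup>2 + (a\<^sup>2 * c - a\<^sup>2 * b) / 4" by (simp add: field_simps)
      have 4: "(e0 - b) * (g * h) \<le> (e0 - b) * T"
        using e0 assms P by (intro mult_left_mono_neg) auto
      define U where "U = b * ((S - a / 2) * (a - S))"
      have 5: "U \<ge> 0" using S assms by (simp add: U_def)
      have 6: "a * e0\<^sup>2 + b * S\<^sup>2 + 2 * ((e0 - b) * T)
               = a * b\<^sup>2 / 4 + a\<^sup>2 * b / 4 - U"
        unfolding e0_def T_def U_def by (simp add: power2_eq_square field_simps)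
      have 7: "b * S\<^sup>2 = b * g\<^sup>2 + b * h\<^sup>2 + 2 * (b * (g * h))"
        by (simp add: S_def power2_eq_square algebra_simps)
      have 8: "(e0 - b) * (g * h) = e0 * (g * h) - b * (g * h)" by (simp add: algebra_simps)
      have 9: "2 * e * g * h = 2 * (e * (g * h))" by simp
      have lin: "ae + bg + ch + x' \<le> abc / 2"
        if "x' = 2 * x" "ae \<le> ae0" "x \<le> y" "ch \<le> bh + (r - q) / 4" "s \<le> t" "0 \<le> U"
          "ae0 + bS + 2 * t = p / 4 + q / 4 - U" "bS = bg + bh + 2 * z" "s = y - z" "p \<le> abc" "r \<le> abc"
        for ae bg ch x' abc x ae0 y bh r q s t bS p z :: real
        using that by (simp add: field_simps)
      show ?thesis by (rule lin[OF 9 1 2 3 4 5 6 7 8 ab(1) ab(2)])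
    qed
    then show ?thesis by (simp add: e_def)
  qed
  then show ?thesis by (simp add: algebra_simps)
qed

text \<open>The determinant with rows \<open>u\<close>, \<open>v\<close>, \<open>w\<close>.\<close>

definition triple :: "real^3 \<Rightarrow> real^3 \<Rightarrow> real^3 \<Rightarrow> real" where
  "triple u v w = u \<bullet> cross3 v w"

lemma triple_swap: "triple v u w = - triple u v w" "triple u w v = - triple u v w"
  by (simp_all add: triple_def cross3_simps)

lemma triple_add_multiple:
  "triple (u + s *\<^sub>R v + t *\<^sub>R w) v w = triple u v w"
  by (simp add: triple_def cross3_simps)

lemma triple_minus: "triple u (- v) w = - triple u v w" "triple u v (- w) = - triple u v w"
  by (simp_all add: triple_def cross3_simps)

lemma triple_sq_eq_gram:
  "(triple u v w)\<^sup>2 = (u \<bullet> u) * (v \<bullet> v) * (w \<bullet> w) + 2 * (v \<bullet> w) * (u \<bullet> w) * (u \<bullet> v)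
     - (u \<bullet> u) * (v \<bullet> w)\<^sup>2 - (v \<bullet> v) * (u \<bullet> w)\<^sup>2 - (w \<bullet> w) * (u \<bullet> v)\<^sup>2"
proof -
  define A :: "real^3^3" where "A = vector [u, v, w]"
  have entry: "(A ** transpose A) $ i $ j = A $ i \<bullet> A $ j" for i j
    by (simp add: matrix_matrix_mult_def transpose_def inner_vec_def)
  have "(triple u v w)\<^sup>2 = det (A ** transpose A)"
    by (simp add: det_mul det_transpose A_def triple_def dot_cross_det power2_eq_square)
  also have "\<dots> = (u \<bullet> u) * (v \<bullet> v) * (w \<bullet> w) + 2 * (v \<bullet> w) * (u \<bullet> w) * (u \<bullet> v)
     - (u \<bullet> u) * (v \<bullet> w)\<^sup>2 - (v \<bullet> v) * (u \<bullet> w)\<^sup>2 - (w \<bullet> w) * (u \<bullet> v)\<^sup>2"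
    unfolding det_3 entry by (simp add: A_def power2_eq_square inner_commute)
  finally show ?thesis .
qed

lemma finite_separated_bounded:
  fixes L :: "(real^3) set"
  assumes diff: "\<And>x y. x \<in> L \<Longrightarrow> y \<in> L \<Longrightarrow> x - y \<in> L"
    and sep: "\<And>x. x \<in> L \<Longrightarrow> x \<noteq> 0 \<Longrightarrow> m \<le> x \<bullet> x" and "0 < m"
  shows "finite {x \<in> L. x \<bullet> x \<le> C}"
proof (rule ccontr)
  let ?S = "{x \<in> L. x \<bullet> x \<le> C}"
  assume inf: "infinite ?S"
  have "bounded ?S"
    by (rule boundedI[of _ "sqrt C"]) (auto simp: norm_eq_sqrt_inner)
  then obtain z where z: "z islimpt ?S"
    using bounded_infinite_imp_islimpt[of ?S ?S] inf by auto
  have "dist x y \<ge> sqrt m" if "x \<in> ?S" "y \<in> ?S" "x \<noteq> y" for x y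
    using sep[of "x - y"] diff that by (simp add: dist_norm norm_eq_sqrt_inner)
  then have "\<not> z islimpt ?S" 
    by (intro discrete_imp_not_islimpt[of "sqrt m"]) (use \<open>0 < m\<close> in \<open>force simp: dist_commute\<close>)+
  with z show False by simp
qed

text \<open>Hermite's constant in dimension three, for the squared minimum \<open>m\<close>. Among the triples
  in \<open>L\<close> whose determinant has the same absolute value choose one of minimal total squared
  length. Adding a multiple of two of its members to the third, permuting, and changing
  signs keep the absolute determinant, so minimality is Minkowski reduction. Fixing the
  determinant replaces the choice of a basis of \<open>L\<close>.\<close>

lemma ternary_hermite:
  fixes L :: "(real^3) set"
  assumes diff: "\<And>x y. x \<in> L \<Longrightarrow> y \<in> L \<Longrightarrow> x - y \<in> L"
    and sep: "\<And>x. x \<in> L \<Longrightarrow> x \<noteq> 0 \<Longrightarrow> m \<le> x \<bullet> x" and "0 < m"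
    and uvw: "u \<in> L" "v \<in> L" "w \<in> L" "triple u v w \<noteq> 0"
  shows "m ^ 3 \<le> 2 * (triple u v w)\<^sup>2"
proof -
  have zero: "0 \<in> L" using diff[OF uvw(1) uvw(1)] by simp
  have minus: "- x \<in> L" if "x \<in> L" for x using diff[OF zero that] by simp
  have plus: "x + y \<in> L" if "x \<in> L" "y \<in> L" for x y using diff[OF that(1) minus[OF that(2)]] by simp
  define B where "B = {(x, y, z). x \<in> L \<and> y \<in> L \<and> z \<in> L \<and> \<bar>triple x y z\<bar> = \<bar>triple u v w\<bar>}"
  define s where "s = (\<lambda>(x :: real^3, y :: real^3, z :: real^3). x \<bullet> x + y \<bullet> y + z \<bullet> z)"
  define C where "C = s (u, v, w)"
  define M where "M = {t \<in> B. s t \<le> C}"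
  have "M \<subseteq> {x \<in> L. x \<bullet> x \<le> C} \<times> {x \<in> L. x \<bullet> x \<le> C} \<times> {x \<in> L. x \<bullet> x \<le> C}"
    unfolding M_def B_def s_def by (auto; smt (verit) inner_ge_zero)
  then have "finite M"
    by (rule finite_subset) (intro finite_cartesian_product finite_separated_bounded[OF diff sep \<open>0 < m\<close>])
  moreover have uvwM: "(u, v, w) \<in> M" using uvw by (simp add: M_def B_def C_def)
  ultimately obtain t where t: "t \<in> M" "\<And>t'. t' \<in> M \<Longrightarrow> s t \<le> s t'"
    using ex_is_arg_min_if_finite[of M s] unfolding is_arg_min_linorder by blast
  define Red where "Red = (\<lambda>x y z. (x, y, z) \<in> B \<and> (\<forall>t \<in> B. s (x, y, z) \<le> s t))"
  have "s t \<le> s t'" if "t' \<in> B" for t'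
    using t that uvwM by (cases "s t' \<le> C") (auto simp: M_def)
  with t have "\<exists>x y z. Red x y z" unfolding Red_def M_def by (cases t) blast
  then obtain x0 y0 z0 where Red0: "Red x0 y0 z0" by blast
  have swap1: "Red y x z" if "Red x y z" for x y z
    using that triple_swap(1)[of y x z] by (auto simp: Red_def B_def s_def algebra_simps)
  have swap2: "Red x z y" if "Red x y z" for x y z
    using that triple_swap(2)[of x z y] by (auto simp: Red_def B_def s_def algebra_simps)
  have neg: "Red x (- y) z" "Red x y (- z)" if "Red x y z" for x y z
    using that minus by (auto simp: Red_def B_def s_def triple_minus)
  have shortest: "x \<bullet> x \<le> x' \<bullet> x'" if "Red x y z" "x' = x + p *\<^sub>R y + q *\<^sub>R z" "p \<in> {-1, 0, 1}" "q \<in> {-1, 0, 1}" for x y z x' p q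
  proof -
    have L: "x \<in> L" "y \<in> L" "z \<in> L" using that(1) by (auto simp: Red_def B_def)
    have scale: "r *\<^sub>R t \<in> L" if "r \<in> {-1, 0, 1}" "t \<in> L" for r t
      using that(1) zero that(2) minus[OF that(2)] by fastforce
    have "p *\<^sub>R y \<in> L" "q *\<^sub>R z \<in> L"
      using scale[OF that(3) L(2)] scale[OF that(4) L(3)] .
    then have "x' \<in> L" unfolding that(2) by (intro plus L)
    then have "(x', y, z) \<in> B" using L that(1) unfolding that(2) by (auto simp: Red_def B_def triple_add_multiple)
    then show ?thesis using that(1) by (force simp: Red_def s_def)
  qed
  (* Order the triple by length, then change signs so that the shortest vector has
     nonnegative inner products with the other two; the sign of the remaining inner product
     stays free. *)
  have "\<exists>x y z. Red x y z \<and> x \<bullet> x \<le> y \<bullet> y \<and> y \<bullet> y \<le> z \<bullet> z"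
  proof -
    have "Red x0 y0 z0" "Red y0 x0 z0" "Red x0 z0 y0" "Red y0 z0 x0" "Red z0 x0 y0" "Red z0 y0 x0"
      using Red0 swap1 swap2 by blast+
    then show ?thesis
      using linear[of "x0 \<bullet> x0" "y0 \<bullet> y0"] linear[of "y0 \<bullet> y0" "z0 \<bullet> z0"] linear[of "x0 \<bullet> x0" "z0 \<bullet> z0"]
      by blast
  qed
  then obtain x y z where ord: "Red x y z" "x \<bullet> x \<le> y \<bullet> y" "y \<bullet> y \<le> z \<bullet> z" by blast
  have "\<exists>y z. Red x y z \<and> x \<bullet> x \<le> y \<bullet> y \<and> y \<bullet> y \<le> z \<bullet> z \<and> 0 \<le> x \<bullet> y \<and> 0 \<le> x \<bullet> z"
  proof -
    define y' where "y' = (if 0 \<le> x \<bullet> y then y else - y)"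
    define z' where "z' = (if 0 \<le> x \<bullet> z then z else - z)"
    have "Red x y' z'" using ord(1) neg by (auto simp: y'_def z'_def)
    then show ?thesis using ord
      by (intro exI[of _ y'] exI[of _ z']) (auto simp: y'_def z'_def)
  qed
  then obtain y z where R: "Red x y z" "x \<bullet> x \<le> y \<bullet> y" "y \<bullet> y \<le> z \<bullet> z" "0 \<le> x \<bullet> y" "0 \<le> x \<bullet> z"
    by blast
  have det: "(triple x y z)\<^sup>2 = (triple u v w)\<^sup>2"
    using R(1) by (auto simp: Red_def B_def power2_eq_iff abs_eq_iff)
  then have "x \<noteq> 0" "x \<in> L" using uvw R(1) by (auto simp: Red_def B_def triple_def)
  then have mx: "m \<le> x \<bullet> x" using sep by blast
  have Ryxz: "Red y x z" and Rzxy: "Red z x y" using R(1) swap1 swap2 by blast+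
  have h: "2 * (x \<bullet> y) \<le> x \<bullet> x"
    using shortest[OF Ryxz, of "y - x" "-1" 0] by (simp add: algebra_simps inner_commute inner_diff_left inner_diff_right)
  have g: "2 * (x \<bullet> z) \<le> x \<bullet> x"
    using shortest[OF Rzxy, of "z - x" "-1" 0] by (simp add: algebra_simps inner_commute inner_diff_left inner_diff_right)
  have f1: "2 * (y \<bullet> z) \<le> y \<bullet> y"
    using shortest[OF Rzxy, of "z - y" 0 "-1"] by (simp add: algebra_simps inner_commute inner_diff_left inner_diff_right)
  have f2: "- 2 * (y \<bullet> z) \<le> y \<bullet> y"
    using shortest[OF Rzxy, of "z + y" 0 "1"] by (simp add: algebra_simps inner_commute inner_add_left inner_add_right)
  have o: "2 * (x \<bullet> z) + 2 * (x \<bullet> y) - 2 * (y \<bullet> z) \<le> x \<bullet> x + y \<bullet> y"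
    using shortest[OF Rzxy, of "z - x + y" "-1" 1]
    by (simp add: algebra_simps inner_commute inner_add_left inner_add_right inner_diff_left inner_diff_right)
  have "(x \<bullet> x) * (y \<bullet> y) * (z \<bullet> z) \<le> 2 * (triple x y z)\<^sup>2"
    unfolding triple_sq_eq_gram
    by (rule reduced_gram_det) (use mx \<open>0 < m\<close> R h g f1 f2 o in auto)
  moreover have "m * m * m \<le> (x \<bullet> x) * (y \<bullet> y) * (z \<bullet> z)"
    using mx R \<open>0 < m\<close> by (intro mult_mono) auto
  ultimately show ?thesis using det by (simp add: power3_eq_cube)
qed

section \<open>The ring of integers and its conjugation\<close>

locale real_quadratic =
  fixes k :: int
  assumes k_gt_1: "k > 1" and squarefree_k: "squarefree k"
begin

abbreviation R :: "real set" where "R \<equiv> carrier (quad_ring k)"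
abbreviation \<omega> :: real where "\<omega> \<equiv> omega k"
abbreviation cj :: "real \<Rightarrow> real" where "cj \<equiv> quad_conj k"
abbreviation eps :: real where "eps \<equiv> fund_unit k"

lemma k0_cases: "k0 k = 1 \<and> k mod 4 \<noteq> 1 \<or> k0 k = 2 \<and> k mod 4 = 1 \<and> k \<ge> 5"
proof -
  have "k \<ge> 5" if "k mod 4 = 1" using that k_gt_1 by presburger
  then show ?thesis by (auto simp: k0_def)
qed

lemma sqrt_k_gt_1: "sqrt (of_int k) > 1"
  using k_gt_1 by simp

lemma mem_R: "x \<in> R \<longleftrightarrow> (\<exists>m n. x = of_int m + of_int n * \<omega>)"
  using carrier_quad_ring[OF k_gt_1] by auto

lemma R_ints [simp]: "of_int m \<in> R"
  unfolding mem_R by (intro exI[of _ m] exI[of _ 0]) simp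

lemma omega_in_R [simp]: "\<omega> \<in> R"
  unfolding mem_R by (intro exI[of _ 0] exI[of _ 1]) simp

lemma R_closed [simp, intro]:
  assumes "x \<in> R" "y \<in> R"
  shows "x + y \<in> R" "x * y \<in> R" "x - y \<in> R"
  using assms quad_ring_closed[of x k y] quad_ring_closed(1)[of x k "- y"] quad_ring_closed(3)[of y k y]
  by auto

lemma R_closed' [simp, intro]:
  "0 \<in> R" "1 \<in> R" "x \<in> R \<Longrightarrow> - x \<in> R" "x \<in> R \<Longrightarrow> x ^ n \<in> R"
proof -
  show "x ^ n \<in> R" if "x \<in> R" using that by (induction n) (auto simp: quad_ring_0_1)
qed (auto simp: quad_ring_0_1 quad_ring_closed(3))

lemma k0_Rats: "k0 k \<in> \<rat>" "k0 k > 0"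
  by (auto simp: k0_def)

lemma R_field_form:
  assumes "a \<in> R"
  obtains x y where "x \<in> \<rat>" "y \<in> \<rat>" "a = x + y * sqrt (of_int k)" "cj a = x - y * sqrt (of_int k)"
proof -
  obtain m n where "a = of_int m + of_int n * \<omega>" using assms mem_R by auto
  then have "a = (of_int m + of_int n / k0 k) + of_int n / k0 k * sqrt (of_int k)"
    by (simp add: omega_def add_divide_distrib algebra_simps)
  moreover have "of_int m + of_int n / k0 k \<in> \<rat>" "of_int n / k0 k \<in> \<rat>"
    using k0_Rats by auto
  ultimately show thesis using that quad_conj_eq[OF squarefree_k k_gt_1] by metis
qed

lemma conj_omega: "cj \<omega> = (1 - sqrt (of_int k)) / k0 k"
proof -
  have "cj (1 / k0 k + 1 / k0 k * sqrt (of_int k)) = 1 / k0 k - 1 / k0 k * sqrt (of_int k)"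
    using k0_Rats by (intro quad_conj_eq squarefree_k k_gt_1) auto
  then show ?thesis by (simp add: omega_def add_divide_distrib diff_divide_distrib)
qed

lemma conj_add [simp]:
  assumes "a \<in> R" "b \<in> R"
  shows "cj (a + b) = cj a + cj b"
proof -
  obtain x y where a: "x \<in> \<rat>" "y \<in> \<rat>" "a = x + y * sqrt (of_int k)" "cj a = x - y * sqrt (of_int k)"
    using R_field_form assms by blast
  obtain u v where b: "u \<in> \<rat>" "v \<in> \<rat>" "b = u + v * sqrt (of_int k)" "cj b = u - v * sqrt (of_int k)"
    using R_field_form assms by blast
  have "cj ((x + u) + (y + v) * sqrt (of_int k)) = (x + u) - (y + v) * sqrt (of_int k)"
    using a b by (intro quad_conj_eq squarefree_k k_gt_1) auto
  then show ?thesis unfolding a(4) b(4) unfolding a(3) b(3) by (simp add: algebra_simps)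
qed

lemma conj_mult [simp]:
  assumes "a \<in> R" "b \<in> R"
  shows "cj (a * b) = cj a * cj b"
proof -
  obtain x y where a: "x \<in> \<rat>" "y \<in> \<rat>" "a = x + y * sqrt (of_int k)" "cj a = x - y * sqrt (of_int k)"
    using R_field_form assms by blast
  obtain u v where b: "u \<in> \<rat>" "v \<in> \<rat>" "b = u + v * sqrt (of_int k)" "cj b = u - v * sqrt (of_int k)"
    using R_field_form assms by blast
  have sq: "sqrt (of_int k) * sqrt (of_int k) = (of_int k :: real)" using k_gt_1 by simp
  have expand: "(x + y * r) * (u + v * r) = (x * u + y * v * n) + (x * v + y * u) * r"
    if "r * r = n" for r n :: real
    by (simp add: algebra_simps flip: that)
  have "cj ((x * u + y * v * of_int k) + (x * v + y * u) * sqrt (of_int k))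
      = (x * u + y * v * of_int k) - (x * v + y * u) * sqrt (of_int k)"
    using a b by (intro quad_conj_eq squarefree_k k_gt_1) auto
  moreover have "a * b = (x * u + y * v * of_int k) + (x * v + y * u) * sqrt (of_int k)"
    unfolding a(3) b(3) by (rule expand[OF sq])
  moreover have "cj a * cj b = (x * u + y * v * of_int k) - (x * v + y * u) * sqrt (of_int k)"
    using expand[of "- sqrt (of_int k)"] sq unfolding a(4) b(4) by simp
  ultimately show ?thesis by simp
qed

lemma conj_int [simp]: "cj (of_int m) = of_int m"
  using quad_conj_eq[OF squarefree_k k_gt_1, of "of_int m" 0] by simp

lemma conj_0_1 [simp]: "cj 0 = 0" "cj 1 = 1"
  using conj_int[of 0] conj_int[of 1] by simp_all

lemma conj_minus [simp]: "a \<in> R \<Longrightarrow> cj (- a) = - cj a"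
  using conj_mult[of "of_int (- 1)" a] conj_int[of "- 1"] R_ints[of "- 1"] by simp

lemma conj_diff [simp]: "a \<in> R \<Longrightarrow> b \<in> R \<Longrightarrow> cj (a - b) = cj a - cj b"
  using conj_add[of a "- b"] by simp

lemma conj_eq_0_iff [simp]:
  assumes "a \<in> R"
  shows "cj a = 0 \<longleftrightarrow> a = 0"
proof -
  obtain x y where a: "x \<in> \<rat>" "y \<in> \<rat>" "a = x + y * sqrt (of_int k)" "cj a = x - y * sqrt (of_int k)"
    using R_field_form assms by blast
  have "y = 0" if "x = y * sqrt (of_int k) \<or> x = - y * sqrt (of_int k)"
  proof (rule ccontr)
    assume "y \<noteq> 0"
    then have "sqrt (of_int k) = x / y \<or> sqrt (of_int k) = - x / y" using that by auto
    moreover have "x / y \<in> \<rat>" "- x / y \<in> \<rat>" using a by auto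
    ultimately show False using sqrt_irrational[OF squarefree_k k_gt_1] by auto
  qed
  then show ?thesis unfolding a(4) unfolding a(3) by (auto simp: algebra_simps)
qed

lemma omega_plus_conj: "\<omega> + cj \<omega> = 2 / k0 k"
  and omega_minus_conj: "\<omega> - cj \<omega> = 2 * sqrt (of_int k) / k0 k"
  unfolding conj_omega using k0_Rats by (simp_all add: omega_def field_simps)

lemma omega_pos: "\<omega> > 0" and conj_omega_neg: "cj \<omega> < 0"
  unfolding conj_omega using sqrt_k_gt_1 k0_Rats
  by (auto simp: omega_def divide_less_0_iff intro!: divide_pos_pos add_pos_pos)

lemma conj_in_R [simp, intro]:
  assumes "a \<in> R"
  shows "cj a \<in> R"
proof -
  obtain m n where a: "a = of_int m + of_int n * \<omega>" using assms mem_R by auto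
  have "2 / k0 k = of_int (if k mod 4 = 1 then 1 else 2)" by (simp add: k0_def)
  then obtain j :: int where "2 / k0 k = of_int j" by blast
  then have "cj \<omega> = of_int j - \<omega>" using omega_plus_conj by simp
  then have "cj a = of_int m + of_int n * (of_int j - \<omega>)" unfolding a by simp
  then show ?thesis by simp
qed

text \<open>Trace and norm of \<open>\<omega>\<close> are integers; for \<open>k \<equiv> 1\<close> modulo 4 the norm is \<open>(1 - k) / 4\<close>.\<close>

lemma norm_is_int:
  assumes "a \<in> R"
  shows "a * cj a \<in> \<int>"
proof -
  obtain m n where a: "a = of_int m + of_int n * \<omega>" using assms mem_R by auto
  have tr: "\<omega> + cj \<omega> \<in> \<int>" unfolding omega_plus_conj by (simp add: k0_def)
  have nm: "\<omega> * cj \<omega> \<in> \<int>"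
  proof -
    have "\<omega> * cj \<omega> = (1 - of_int k) / (k0 k)\<^sup>2"
      unfolding conj_omega using k0_Rats k_gt_1 by (simp add: omega_def power2_eq_square algebra_simps)
    also have "\<dots> = of_int (if k mod 4 = 1 then - ((k - 1) div 4) else 1 - k)"
    proof (cases "k mod 4 = 1")
      case True
      then have "k = 4 * ((k - 1) div 4) + 1" by presburger
      then have "of_int k = (4 * of_int ((k - 1) div 4) + 1 :: real)"
        by (metis of_int_1 of_int_add of_int_mult of_int_numeral)
      then show ?thesis using True by (simp add: k0_def)
    qed (simp add: k0_def)
    finally show ?thesis by simp
  qed
  have "a * cj a = of_int (m * m) + of_int (m * n) * (\<omega> + cj \<omega>) + of_int (n * n) * (\<omega> * cj \<omega>)"
    unfolding a by (simp add: algebra_simps)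
  then show ?thesis using tr nm by (metis Ints_add Ints_mult Ints_of_int)
qed

lemma norm_ge_1:
  assumes "a \<in> R" "a \<noteq> 0"
  shows "\<bar>a * cj a\<bar> \<ge> 1"
  using Ints_nonzero_abs_ge1[OF norm_is_int[OF assms(1)]] assms by simp

text \<open>Under the two embeddings \<open>R\<close> is a lattice in the plane; the difference of the two
  conjugates controls the coefficient of \<open>\<omega>\<close>, and then the size controls the other one.\<close>

lemma finite_bounded_R: "finite {a \<in> R. \<bar>a\<bar> \<le> C \<and> \<bar>cj a\<bar> \<le> C}"
proof -
  define M where "M = \<lceil>2 * C\<rceil>"
  define M' where "M' = \<lceil>C + M * \<omega>\<rceil>"
  have gap: "\<omega> - cj \<omega> \<ge> 1"
  proof -
    have "k0 k = 1 \<or> k0 k = 2" using k0_cases by auto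
    then show ?thesis unfolding omega_minus_conj using sqrt_k_gt_1 k_gt_1
      by (elim disjE) (simp_all del: real_sqrt_gt_1_iff)
  qed
  have "a \<in> (\<lambda>(m, n). of_int m + of_int n * \<omega>) ` ({- M'..M'} \<times> {- M..M})"
    if a: "a \<in> R" "\<bar>a\<bar> \<le> C" "\<bar>cj a\<bar> \<le> C" for a
  proof -
    obtain m n where mn: "a = of_int m + of_int n * \<omega>" using a mem_R by auto
    have "a - cj a = of_int n * (\<omega> - cj \<omega>)" unfolding mn by (simp add: algebra_simps)
    then have "\<bar>of_int n\<bar> * (\<omega> - cj \<omega>) = \<bar>a - cj a\<bar>" using gap by (simp add: abs_mult)
    also have "\<dots> \<le> 2 * C" using a by linarith
    finally have n: "\<bar>of_int n\<bar> \<le> 2 * C"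
      using mult_left_mono[OF gap, of "\<bar>of_int n\<bar>"] by simp
    then have n': "\<bar>n\<bar> \<le> M" unfolding M_def by linarith
    then have "\<bar>of_int n * \<omega>\<bar> \<le> M * \<omega>" using omega_pos by (simp add: abs_mult)
    then have "\<bar>of_int m\<bar> \<le> C + M * \<omega>" using mn a by linarith
    then have "\<bar>m\<bar> \<le> M'" unfolding M'_def by linarith
    then show ?thesis using n' mn by (intro image_eqI[of _ _ "(m, n)"]) auto
  qed
  then have "{a \<in> R. \<bar>a\<bar> \<le> C \<and> \<bar>cj a\<bar> \<le> C} \<subseteq> (\<lambda>(m, n). of_int m + of_int n * \<omega>) ` ({- M'..M'} \<times> {- M..M})"
    by blast
  then show ?thesis
    by (rule finite_subset) (intro finite_imageI finite_cartesian_product finite_atLeastAtMost_int)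
qed

section \<open>Units\<close>

lemma Units_iff: "u \<in> Units (quad_ring k) \<longleftrightarrow> u \<in> R \<and> (\<exists>v\<in>R. u * v = 1)"
  by (auto simp: Units_def quad_ring_def mult.commute)

lemma unit_nonzero: "u \<in> Units (quad_ring k) \<Longrightarrow> u \<noteq> 0"
  by (auto simp: Units_iff)

lemma unit_inverse:
  assumes "u \<in> Units (quad_ring k)"
  shows "inverse u \<in> Units (quad_ring k)" "u \<in> R" "inverse u \<in> R"
proof -
  obtain v where v: "u \<in> R" "v \<in> R" "u * v = 1" using assms Units_iff by auto
  then have "inverse u = v" by (simp add: inverse_unique)
  then show "inverse u \<in> Units (quad_ring k)" "u \<in> R" "inverse u \<in> R"
    using v by (auto simp: Units_iff mult.commute)
qed

lemma unit_mult:
  assumes "u \<in> Units (quad_ring k)" "v \<in> Units (quad_ring k)"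
  shows "u * v \<in> Units (quad_ring k)"
proof -
  have "(u * v) * (inverse u * inverse v) = 1"
    using unit_nonzero[OF assms(1)] unit_nonzero[OF assms(2)] by (simp add: field_simps)
  then show ?thesis using assms unit_inverse unfolding Units_iff by blast
qed

lemma unit_power: "u \<in> Units (quad_ring k) \<Longrightarrow> u ^ n \<in> Units (quad_ring k)"
  by (induction n) (auto simp: unit_mult Units_iff[of 1])

lemma unit_minus: "u \<in> Units (quad_ring k) \<Longrightarrow> - u \<in> Units (quad_ring k)"
  unfolding Units_iff by (metis R_closed'(3) minus_mult_minus)

lemma conj_unit_inverse:
  assumes "u \<in> Units (quad_ring k)"
  shows "cj (inverse u) = inverse (cj u)"
proof -
  have "cj u * cj (inverse u) = cj (u * inverse u)" using unit_inverse[OF assms] by simp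
  then show ?thesis using unit_nonzero[OF assms] by (simp add: inverse_unique)
qed

lemma norm_unit:
  assumes "u \<in> Units (quad_ring k)"
  shows "\<bar>u\<bar> * \<bar>cj u\<bar> = 1"
proof -
  have "\<bar>u * cj u\<bar> \<ge> 1" "\<bar>inverse u * cj (inverse u)\<bar> \<ge> 1"
    using unit_inverse[OF assms] unit_nonzero[OF assms] by (intro norm_ge_1; simp)+
  then have "\<bar>u * cj u\<bar> \<ge> 1" "inverse \<bar>u * cj u\<bar> \<ge> 1"
    unfolding conj_unit_inverse[OF assms] by (auto simp: abs_mult)
  then have "\<bar>u * cj u\<bar> = 1" unfolding one_le_inverse_iff by linarith
  then show ?thesis by (simp add: abs_mult)
qed

text \<open>Each pair comes from a Dirichlet approximation \<open>x / y\<close> of \<open>\<surd>k\<close>. The approximation can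
  be made better than any given finite set of them, since \<open>\<surd>k\<close> is irrational.\<close>

lemma pell_approximations_infinite:
  "infinite {(x :: int, y :: int). 0 < y \<and> \<bar>x\<^sup>2 - k * y\<^sup>2\<bar> \<le> 1 + 2 * k}" (is "infinite ?P")
proof
  assume fin: "finite ?P"
  define r where "r = sqrt (of_int k)"
  have irr: "of_int y * r - of_int x \<noteq> 0" if "y \<noteq> 0" for x y :: int
  proof
    assume "of_int y * r - of_int x = 0"
    then have "r = of_int x / of_int y" using that by (simp add: field_simps)
    then show False using sqrt_irrational[OF squarefree_k k_gt_1] by (simp add: r_def)
  qed
  define E where "E = (\<lambda>(x :: int, y :: int). \<bar>of_int y * r - of_int x\<bar>) ` ?P"
  obtain N :: nat where N: "N > 0" "\<forall>e\<in>E. 1 / real N < e"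
  proof -
    have "\<forall>e\<in>E. 0 < e" using irr by (force simp: E_def)
    then have "0 < Min (insert 1 E)" using fin by (subst Min_gr_iff) (auto simp: E_def)
    then obtain N where "inverse (real (Suc N)) < Min (insert 1 E)"
      using reals_Archimedean by blast
    then show thesis using that[of "Suc N"] fin by (auto simp: E_def inverse_eq_divide)
  qed
  obtain x y where xy: "0 < y" "y \<le> int N" "\<bar>of_int y * r - of_int x\<bar> < 1 / N"
    using Dirichlet_approx[OF N(1), of r] by metis
  define \<delta> where "\<delta> = of_int y * r - of_int x"
  have rk: "r * r = of_int k" "0 < r" using k_gt_1 by (auto simp: r_def)
  have "r \<le> of_int k" unfolding r_def using k_gt_1 by (simp add: real_le_lsqrt power2_eq_square)
  have yN: "of_int y * (1 / real N) \<le> 1" using xy N(1) by (simp add: field_simps)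
  have N1: "1 / real N \<le> 1" using N(1) by simp
  have "of_int (x\<^sup>2 - k * y\<^sup>2) = - \<delta> * (2 * of_int y * r - \<delta>)"
    using rk(1) by (simp add: \<delta>_def power2_eq_square algebra_simps)
  then have "\<bar>of_int (x\<^sup>2 - k * y\<^sup>2)\<bar> = \<bar>\<delta>\<bar> * \<bar>2 * of_int y * r - \<delta>\<bar>" by (simp add: abs_mult)
  also have "\<dots> \<le> (1 / real N) * (2 * of_int y * r + 1)"
  proof (intro mult_mono)
    have "\<bar>\<delta>\<bar> \<le> 1" using xy(3) N1 unfolding \<delta>_def by linarith
    moreover have "0 \<le> 2 * of_int y * r" using xy(1) rk(2) by simp
    ultimately show "\<bar>2 * of_int y * r - \<delta>\<bar> \<le> 2 * of_int y * r + 1" by linarith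
  qed (use xy in \<open>auto simp: \<delta>_def\<close>)
  also have "\<dots> = 2 * r * (of_int y * (1 / real N)) + 1 / real N" by (simp add: algebra_simps)
  also have "\<dots> \<le> 2 * r * 1 + 1" using yN N1 rk by (intro add_mono mult_left_mono) auto
  also have "\<dots> \<le> of_int (1 + 2 * k)" using \<open>r \<le> of_int k\<close> by simp
  finally have "\<bar>x\<^sup>2 - k * y\<^sup>2\<bar> \<le> 1 + 2 * k" by linarith
  then have "(x, y) \<in> ?P" using xy by simp
  then have "\<bar>of_int y * r - of_int x\<bar> \<in> E" unfolding E_def by force
  then show False using N(2) xy(3) by fastforce
qed

text \<open>Two of infinitely many elements \<open>a + b \<surd>k\<close>, \<open>c + d \<surd>k\<close> of bounded norm have the same
  norm \<open>n\<close> and are congruent modulo \<open>n\<close>. Their quotient then lies in \<open>R\<close>, and so does its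
  inverse.\<close>

lemma exists_unit_gt_1: "\<exists>u \<in> Units (quad_ring k). 1 < u"
proof -
  define P where "P = {(x :: int, y :: int). 0 < y \<and> \<bar>x\<^sup>2 - k * y\<^sup>2\<bar> \<le> 1 + 2 * k}"
  define key where "key = (\<lambda>(x, y). (x\<^sup>2 - k * y\<^sup>2, x mod (x\<^sup>2 - k * y\<^sup>2), y mod (x\<^sup>2 - k * y\<^sup>2)))"
  define r where "r = sqrt (of_int k)"
  have r: "r \<in> R" "r * r = of_int k" "r > 1"
  proof -
    have "r = of_int (if k mod 4 = 1 then 2 else 1) * \<omega> - 1" by (simp add: omega_def k0_def r_def add_divide_distrib)
    then show "r \<in> R" by (metis R_closed(2,3) R_closed'(2) R_ints omega_in_R)
  qed (use k_gt_1 in \<open>auto simp: r_def\<close>)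
  have irr: "x\<^sup>2 - k * y\<^sup>2 \<noteq> 0" if "0 < y" for x y
  proof
    assume "x\<^sup>2 - k * y\<^sup>2 = 0"
    then have "(of_int x / of_int y)\<^sup>2 = (of_int k :: real)" using that
      by (simp add: power_divide field_simps flip: of_int_power of_int_mult)
    then have "sqrt (of_int k) = \<bar>of_int x / of_int y\<bar>" by (metis real_sqrt_abs)
    then show False using sqrt_irrational[OF squarefree_k k_gt_1] by simp
  qed
  have key_range: "key p \<in> {- (1 + 2 * k)..1 + 2 * k} \<times> {- (1 + 2 * k)..1 + 2 * k} \<times> {- (1 + 2 * k)..1 + 2 * k}"
    if "p \<in> P" for p
  proof -
    obtain x y where p: "p = (x, y)" by (cases p)
    define n where "n = x\<^sup>2 - k * y\<^sup>2"
    have n: "n \<noteq> 0" "\<bar>n\<bar> \<le> 1 + 2 * k" using that irr by (auto simp: P_def p n_def)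
    then have "\<bar>x mod n\<bar> \<le> 1 + 2 * k" "\<bar>y mod n\<bar> \<le> 1 + 2 * k"
      using abs_mod_less[OF n(1), of x] abs_mod_less[OF n(1), of y] by linarith+
    moreover have "key p = (n, x mod n, y mod n)" by (simp add: key_def p n_def)
    ultimately show ?thesis using n(2) by (simp only: mem_Times_iff fst_conv snd_conv atLeastAtMost_iff) linarith
  qed
  then have "finite (key ` P)"
    by (intro finite_subset[OF image_subsetI[OF key_range]] finite_cartesian_product finite_atLeastAtMost_int)
  then have "\<not> inj_on key P"
    using pell_approximations_infinite finite_imageD[of key P] unfolding P_def[symmetric] by blast
  then obtain p q where pq: "p \<in> P" "q \<in> P" "p \<noteq> q" "key p = key q" unfolding inj_on_def by blast
  obtain a b c d where abcd: "p = (a, b)" "q = (c, d)" by (metis surj_pair)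
  define n where "n = a\<^sup>2 - k * b\<^sup>2"
  have n: "n \<noteq> 0" "c\<^sup>2 - k * d\<^sup>2 = n" "a mod n = c mod n" "b mod n = d mod n" "0 < b" "0 < d"
    using pq irr abcd by (auto simp: n_def P_def key_def)
  obtain i where i: "a = c + n * i" using n(3) by (metis mod_eqE mult.commute)
  obtain j where j: "b = d + n * j" using n(4) by (metis mod_eqE mult.commute)
  have nr: "of_int n = (of_int c + of_int d * r) * (of_int c - of_int d * r)"
    unfolding n(2)[symmetric] using r(2) by (simp add: power2_eq_square algebra_simps)
  have nr': "of_int n = (of_int a + of_int b * r) * (of_int a - of_int b * r)"
    using r(2) by (simp add: n_def power2_eq_square algebra_simps)
  (* These are the quotient of a + b r by c + d r and its conjugate, written so that
     membership in R is visible. *)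
  define \<eta> where "\<eta> = 1 + (of_int i + of_int j * r) * (of_int c - of_int d * r)"
  define \<eta>' where "\<eta>' = 1 + (of_int i - of_int j * r) * (of_int c + of_int d * r)"
  have 1: "\<eta> * (of_int c + of_int d * r) = of_int a + of_int b * r"
    unfolding \<eta>_def i j by (simp add: nr algebra_simps)
  have 2: "\<eta>' * (of_int c - of_int d * r) = of_int a - of_int b * r"
    unfolding \<eta>'_def i j by (simp add: nr algebra_simps)
  have "(\<eta> * \<eta>') * of_int n = of_int n"
    using arg_cong2[OF 1 2, of "(*)"] unfolding nr[symmetric] nr'[symmetric] 
    by (simp add: nr algebra_simps)
  then have unit: "\<eta> * \<eta>' = 1" using n(1) by simp
  have mem: "\<eta> \<in> R" "\<eta>' \<in> R" using r(1) by (auto simp: \<eta>_def \<eta>'_def)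
  have lin: "x = 0 \<and> y = 0" if "of_int x + of_int y * r = 0" for x y :: int
  proof -
    have "y = 0"
    proof (rule ccontr)
      assume "y \<noteq> 0"
      then have "r = - of_int x / of_int y" using that by (simp add: field_simps)
      then show False using sqrt_irrational[OF squarefree_k k_gt_1] by (simp add: r_def)
    qed
    then show ?thesis using that by simp
  qed
  have "\<eta> \<noteq> 1" using 1 lin[of "c - a" "d - b"] pq(3) abcd by (auto simp: algebra_simps)
  moreover have "\<eta> \<noteq> - 1" using 1 lin[of "c + a" "d + b"] n(5,6) by (auto simp: algebra_simps)
  ultimately have gt_1: "\<bar>\<eta>\<bar> > 1 \<or> \<bar>\<eta>'\<bar> > 1"
  proof -
    have prod: "\<bar>\<eta>\<bar> * \<bar>\<eta>'\<bar> = 1" using unit by (simp flip: abs_mult)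
    have "\<bar>\<eta>\<bar> \<noteq> 1" using \<open>\<eta> \<noteq> 1\<close> \<open>\<eta> \<noteq> - 1\<close> by linarith
    moreover have "\<not> (\<bar>\<eta>\<bar> < 1 \<and> \<bar>\<eta>'\<bar> \<le> 1)"
      using mult_left_mono[of "\<bar>\<eta>'\<bar>" 1 "\<bar>\<eta>\<bar>"] prod by auto
    ultimately show ?thesis by linarith
  qed
  have "\<eta> \<in> Units (quad_ring k)" "\<eta>' \<in> Units (quad_ring k)"
    using mem unit by (auto simp: Units_iff mult.commute)
  then have "\<bar>\<eta>\<bar> \<in> Units (quad_ring k)" "\<bar>\<eta>'\<bar> \<in> Units (quad_ring k)"
    using unit_minus by (auto simp: abs_if)
  then show ?thesis using gt_1 by blast
qed

text \<open>Units between \<open>1\<close> and a given bound have conjugates of absolute value at most \<open>1\<close>, so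
  there are finitely many of them and the \<open>LEAST\<close> in the definition of \<open>fund_unit\<close> is
  attained.\<close>

lemma fund_unit_props: "eps \<in> Units (quad_ring k)" "1 < eps"
  and fund_unit_least: "\<And>u. u \<in> Units (quad_ring k) \<Longrightarrow> 1 < u \<Longrightarrow> eps \<le> u"
proof -
  obtain u0 where u0: "u0 \<in> Units (quad_ring k)" "1 < u0" using exists_unit_gt_1 by auto
  define S where "S = {u \<in> Units (quad_ring k). 1 < u \<and> u \<le> u0}"
  have "S \<subseteq> {a \<in> R. \<bar>a\<bar> \<le> u0 \<and> \<bar>cj a\<bar> \<le> u0}"
  proof
    fix u assume u: "u \<in> S"
    then have "\<bar>u\<bar> * \<bar>cj u\<bar> = 1" "1 < u" using norm_unit[of u] by (auto simp: S_def)
    then have "\<bar>cj u\<bar> \<le> 1" by (smt (verit) mult_le_cancel_right1)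
    then show "u \<in> {a \<in> R. \<bar>a\<bar> \<le> u0 \<and> \<bar>cj a\<bar> \<le> u0}"
      using u u0 unit_inverse by (auto simp: S_def)
  qed
  then have fin: "finite S" using finite_bounded_R finite_subset by blast
  moreover have "u0 \<in> S" using u0 by (simp add: S_def)
  ultimately have Min: "Min S \<in> S" "\<And>u. u \<in> S \<Longrightarrow> Min S \<le> u" by (auto intro: Min_in)
  have least: "Min S \<le> u" if "u \<in> Units (quad_ring k)" "1 < u" for u
    using that Min(2)[of u] Min(2)[OF \<open>u0 \<in> S\<close>] by (cases "u \<le> u0") (auto simp: S_def)
  have "eps = Min S" unfolding fund_unit_def
    by (rule Least_equality) (use Min(1) least in \<open>auto simp: S_def\<close>)
  then show "eps \<in> Units (quad_ring k)" "1 < eps"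
    and "\<And>u. u \<in> Units (quad_ring k) \<Longrightarrow> 1 < u \<Longrightarrow> eps \<le> u"
    using Min(1) least by (auto simp: S_def)
qed

lemma units_are_powers:
  assumes "u \<in> Units (quad_ring k)"
  obtains n where "\<bar>u\<bar> = eps ^ n \<or> \<bar>u\<bar> = inverse (eps ^ n)"
proof -
  have power: "\<exists>n. v = eps ^ n" if v: "v \<in> Units (quad_ring k)" "1 \<le> v" for v
  proof -
    obtain n where n: "eps ^ n \<le> v" "v < eps ^ Suc n"
    proof -
      obtain N where "v < eps ^ N" using real_arch_pow fund_unit_props by blast
      moreover define m where "m = (LEAST N. v < eps ^ N)"
      ultimately have m: "v < eps ^ m" "\<And>j. j < m \<Longrightarrow> \<not> v < eps ^ j"
        by (auto intro: LeastI dest: not_less_Least)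
      then have "m \<noteq> 0" using v by (auto intro: ccontr)
      then show thesis using that[of "m - 1"] m(1) m(2)[of "m - 1"] by auto
    qed
    have pos: "0 < eps ^ n" using fund_unit_props by simp
    have "v * inverse (eps ^ n) \<in> Units (quad_ring k)"
      by (intro unit_mult unit_inverse(1) unit_power v(1) fund_unit_props(1))
    moreover have "v * inverse (eps ^ n) < eps" "1 \<le> v * inverse (eps ^ n)"
      using n pos by (auto simp: field_simps)
    ultimately have "v * inverse (eps ^ n) = 1" using fund_unit_least[of "v * inverse (eps ^ n)"] by linarith
    then show ?thesis using pos by (auto simp: field_simps)
  qed
  have au: "\<bar>u\<bar> \<in> Units (quad_ring k)" using assms unit_minus by (auto simp: abs_if)
  show thesis
  proof (cases "1 \<le> \<bar>u\<bar>")
    case True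
    then show thesis using power au that by blast
  next
    case False
    then have "1 \<le> inverse \<bar>u\<bar>" using unit_nonzero[OF assms] by (simp add: one_le_inverse)
    then obtain n where "inverse \<bar>u\<bar> = eps ^ n" using power unit_inverse[OF au] by blast
    then show thesis using that[of n] by (metis inverse_inverse_eq)
  qed
qed

end

section \<open>Points at which the cusp at infinity is highest\<close>

text \<open>For the point \<open>z = x + y i\<close> of the upper half plane this is \<open>\<bar>c z + d\<bar>\<^sup>2\<close>.\<close>

definition cocycle_sq :: "real \<Rightarrow> real \<Rightarrow> real \<Rightarrow> real \<Rightarrow> real" where
  "cocycle_sq x y c d = (c * x + d)\<^sup>2 + (c * y)\<^sup>2"

lemma cocycle_sq_nonneg: "0 \<le> cocycle_sq x y c d"
  by (simp add: cocycle_sq_def)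

lemma cocycle_sq_scale:
  assumes "u \<noteq> 0"
  shows "cocycle_sq (u\<^sup>2 * x) (u\<^sup>2 * y) c d = u\<^sup>2 * cocycle_sq x y (c * u) (d / u)"
  using assms by (simp add: cocycle_sq_def power2_eq_square field_simps)

context real_quadratic
begin

text \<open>The pair \<open>(0, 1)\<close> gives the product \<open>1\<close>: the point \<open>(x1 + y1 i, x2 + y2 i)\<close> is at
  least as high above the cusp at infinity as above any other.\<close>

definition cusp_highest :: "real \<Rightarrow> real \<Rightarrow> real \<Rightarrow> real \<Rightarrow> bool" where
  "cusp_highest x1 y1 x2 y2 \<longleftrightarrow> 0 < y1 \<and> 0 < y2 \<and>
     (\<forall>c\<in>R. \<forall>d\<in>R. (c, d) \<noteq> (0, 0) \<longrightarrow> 1 \<le> cocycle_sq x1 y1 c d * cocycle_sq x2 y2 (cj c) (cj d))"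

text \<open>Restrict \<open>c\<close> to the integers \<open>n\<close>. The vectors \<open>pt n d\<close> form a lattice of rank three in
  which the squared length of \<open>pt n d\<close> is \<open>(y2 / y1) \<bar>n z1 + d\<bar>\<^sup>2 + (y1 / y2) \<bar>n z2 +
  d'\<bar>\<^sup>2\<close>, at least \<open>2\<close> by the inequality of arithmetic and geometric means. The square of
  its determinant is \<open>2 y1 y2 (\<omega> - \<omega>')\<^sup>2\<close>: the weights \<open>y2 / y1\<close> and \<open>y1 / y2\<close> are those for
  which this is smallest. Hermite's constant gives the claim.\<close>

lemma height_lower_bound:
  assumes "cusp_highest x1 y1 x2 y2"
  shows "(k0 k)\<^sup>2 / (2 * of_int k) \<le> y1 * y2"
proof -
  have y: "0 < y1" "0 < y2" using assms by (auto simp: cusp_highest_def)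
  define p q where "p = sqrt (y2 / y1)" and "q = sqrt (y1 / y2)"
  have pq: "p * q = 1" "p\<^sup>2 = y2 / y1" "q\<^sup>2 = y1 / y2"
    using y by (auto simp: p_def q_def simp flip: real_sqrt_mult)
  define pt :: "int \<Rightarrow> real \<Rightarrow> real^3" where
    "pt = (\<lambda>n d. vector [sqrt (2 * (y1 * y2)) * of_int n, p * (of_int n * x1 + d), q * (of_int n * x2 + cj d)])"
  define L where "L = {pt n d | n d. d \<in> R}"
  have L: "pt n d \<in> L" if "d \<in> R" for n d using that by (auto simp: L_def)
  have vol: "triple (pt 1 0) (pt 0 1) (pt 0 \<omega>) = sqrt (2 * (y1 * y2)) * ((p * q) * (cj \<omega> - \<omega>))"
    by (simp add: triple_def pt_def cross3_simps)
  have "2 ^ 3 \<le> 2 * (triple (pt 1 0) (pt 0 1) (pt 0 \<omega>))\<^sup>2"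
  proof (rule ternary_hermite)
    fix v w assume "v \<in> L" "w \<in> L"
    then obtain n d m e where vw: "v = pt n d" "w = pt m e" "d \<in> R" "e \<in> R" by (auto simp: L_def)
    then have "v - w = pt (n - m) (d - e)"
      by (simp add: pt_def vec_eq_iff forall_3 algebra_simps)
    then show "v - w \<in> L" using vw L by simp
  next
    fix v assume "v \<in> L" "v \<noteq> 0"
    then obtain n d where v: "v = pt n d" "d \<in> R" by (auto simp: L_def)
    have "(n, d) \<noteq> (0, 0)" using v \<open>v \<noteq> 0\<close> by (auto simp: pt_def vec_eq_iff forall_3)
    define A B where "A = cocycle_sq x1 y1 (of_int n) d" and "B = cocycle_sq x2 y2 (of_int n) (cj d)"
    have AB: "1 \<le> A * B" "0 \<le> A" "0 \<le> B"
      using assms v \<open>(n, d) \<noteq> (0, 0)\<close> unfolding cusp_highest_def A_def B_def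
      by (metis R_ints conj_int of_int_eq_0_iff prod.inject, auto simp: cocycle_sq_nonneg)
    have "v \<bullet> v = 2 * (y1 * y2) * (of_int n)\<^sup>2 + p\<^sup>2 * (of_int n * x1 + d)\<^sup>2 + q\<^sup>2 * (of_int n * x2 + cj d)\<^sup>2"
      using y by (simp add: v pt_def inner_vec_def sum_3 power_mult_distrib flip: power2_eq_square)
    also have "\<dots> = (y2 / y1) * A + (y1 / y2) * B"
      unfolding pq(2,3) A_def B_def cocycle_sq_def using y by (simp add: field_simps power2_eq_square)
    finally have "v \<bullet> v = (y2 / y1) * A + (y1 / y2) * B" .
    moreover have "2\<^sup>2 \<le> ((y2 / y1) * A + (y1 / y2) * B)\<^sup>2"
    proof -
      have square_sum: "(X + Y)\<^sup>2 = (X - Y)\<^sup>2 + 4 * (X * Y)" for X Y :: real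
        by (simp add: power2_eq_square algebra_simps)
      have "(y2 / y1 * A) * (y1 / y2 * B) = A * B" using y by simp
      moreover have "((y2 / y1) * A + (y1 / y2) * B)\<^sup>2 = ((y2 / y1) * A - (y1 / y2) * B)\<^sup>2 + 4 * ((y2 / y1 * A) * (y1 / y2 * B))"
        using square_sum[of "(y2 / y1) * A" "(y1 / y2) * B"] .
      ultimately have "4 \<le> ((y2 / y1) * A + (y1 / y2) * B)\<^sup>2"
        using AB(1) zero_le_power2[of "(y2 / y1) * A - (y1 / y2) * B"] by linarith
      then show ?thesis by simp
    qed
    ultimately have "2\<^sup>2 \<le> (v \<bullet> v)\<^sup>2" by (simp only:)
    then show "2 \<le> v \<bullet> v" by (rule power2_le_imp_le) simp
  next
    show "triple (pt 1 0) (pt 0 1) (pt 0 \<omega>) \<noteq> 0"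
      unfolding vol pq(1) using y omega_pos conj_omega_neg by simp
  qed (auto intro: L)
  also have "(triple (pt 1 0) (pt 0 1) (pt 0 \<omega>))\<^sup>2 = (2 * (y1 * y2)) * (\<omega> - cj \<omega>)\<^sup>2"
    unfolding vol pq(1) using y by (simp add: power_mult_distrib power2_commute)
  also have "(\<omega> - cj \<omega>)\<^sup>2 = 4 * of_int k / (k0 k)\<^sup>2"
    unfolding omega_minus_conj using k_gt_1 by (simp add: power_divide power_mult_distrib)
  finally show ?thesis using k0_Rats k_gt_1 by (simp add: field_simps)
qed

text \<open>The flag \<open>b\<close> chooses which end of the range of \<open>t\<close> belongs to the cell. The strict
  inequalities in \<open>couples\<close> require both choices.\<close>

lemma translate_into_cell:
  obtains \<beta> s t where "\<beta> \<in> R" "x1 + \<beta> = s + t * \<omega>" "x2 + cj \<beta> = s + t * cj \<omega>" "- 1 / 2 \<le> s" "s < 1 / 2"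
    "if b then - 1 / 2 < t \<and> t \<le> 1 / 2 else - 1 / 2 \<le> t \<and> t < 1 / 2"
proof -
  define t0 where "t0 = (x1 - x2) / (\<omega> - cj \<omega>)"
  define s0 where "s0 = x1 - t0 * \<omega>"
  define m n where "m = \<lfloor>s0 + 1 / 2\<rfloor>" and "n = (if b then \<lceil>t0 - 1 / 2\<rceil> else \<lfloor>t0 + 1 / 2\<rfloor>)"
  define \<beta> where "\<beta> = - (of_int m + of_int n * \<omega>)"
  have "t0 * (\<omega> - cj \<omega>) = x1 - x2" using omega_pos conj_omega_neg by (simp add: t0_def)
  then have "x2 = s0 + t0 * cj \<omega>" by (simp add: s0_def algebra_simps)
  then have "x2 + cj \<beta> = (s0 - m) + (t0 - n) * cj \<omega>" by (simp add: \<beta>_def algebra_simps)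
  moreover have "x1 + \<beta> = (s0 - m) + (t0 - n) * \<omega>" by (simp add: \<beta>_def s0_def algebra_simps)
  moreover have "- 1 / 2 \<le> s0 - m" "s0 - m < 1 / 2" unfolding m_def by linarith+
  moreover have "if b then - 1 / 2 < t0 - n \<and> t0 - n \<le> 1 / 2 else - 1 / 2 \<le> t0 - n \<and> t0 - n < 1 / 2"
    unfolding n_def by (cases b) (simp_all, linarith+)
  ultimately show thesis using that[of \<beta> "s0 - m" "t0 - n"] by (simp add: \<beta>_def)
qed

lemma cell_bound:
  assumes "\<bar>s\<bar> \<le> 1 / 2" "\<bar>t\<bar> \<le> (1 / 2 :: real)"
  shows "\<bar>s + t * \<omega>\<bar> \<le> (1 + \<omega>) / 2" "\<bar>s + t * cj \<omega>\<bar> \<le> (1 - cj \<omega>) / 2"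
    and "\<bar>s\<bar> < 1 / 2 \<or> \<bar>t\<bar> < 1 / 2 \<Longrightarrow> \<bar>s + t * \<omega>\<bar> < (1 + \<omega>) / 2 \<and> \<bar>s + t * cj \<omega>\<bar> < (1 - cj \<omega>) / 2"
proof -
  have 1: "\<bar>t * \<omega>\<bar> \<le> \<omega> / 2" "\<bar>t * cj \<omega>\<bar> \<le> - cj \<omega> / 2"
    using assms(2) omega_pos conj_omega_neg mult_right_mono[of "\<bar>t\<bar>" "1 / 2" \<omega>] mult_right_mono[of "\<bar>t\<bar>" "1 / 2" "- cj \<omega>"]
    by (auto simp: abs_mult)
  then show "\<bar>s + t * \<omega>\<bar> \<le> (1 + \<omega>) / 2" "\<bar>s + t * cj \<omega>\<bar> \<le> (1 - cj \<omega>) / 2"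
    using assms(1) unfolding add_divide_distrib diff_divide_distrib by linarith+
  have 2: "\<bar>t * \<omega>\<bar> < \<omega> / 2" "\<bar>t * cj \<omega>\<bar> < - cj \<omega> / 2" if "\<bar>t\<bar> < 1 / 2"
    using that omega_pos conj_omega_neg mult_strict_right_mono[of "\<bar>t\<bar>" "1 / 2" \<omega>] mult_strict_right_mono[of "\<bar>t\<bar>" "1 / 2" "- cj \<omega>"]
    by (auto simp: abs_mult)
  show "\<bar>s + t * \<omega>\<bar> < (1 + \<omega>) / 2 \<and> \<bar>s + t * cj \<omega>\<bar> < (1 - cj \<omega>) / 2" if "\<bar>s\<bar> < 1 / 2 \<or> \<bar>t\<bar> < 1 / 2"
    using that 1 2 assms(1) unfolding add_divide_distrib diff_divide_distrib by (auto; linarith)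
qed

text \<open>The first coordinate attains its bound only at the corners where the coefficients \<open>s\<close>,
  \<open>t\<close> are \<open>\<plusminus>1 / 2\<close> with equal signs, since \<open>\<omega> > 0\<close>. This choice of cell avoids them. The
  second coordinate, with \<open>\<omega>' < 0\<close>, behaves the opposite way.\<close>

lemma translate_strict_first:
  obtains \<beta> where "\<beta> \<in> R" "\<bar>x1 + \<beta>\<bar> < (1 + \<omega>) / 2" "\<bar>x2 + cj \<beta>\<bar> \<le> (1 - cj \<omega>) / 2"
proof -
  obtain \<beta> s t where b: "\<beta> \<in> R" "x1 + \<beta> = s + t * \<omega>" "x2 + cj \<beta> = s + t * cj \<omega>"
     "- 1 / 2 \<le> s" "s < 1 / 2" "if True then - 1 / 2 < t \<and> t \<le> 1 / 2 else - 1 / 2 \<le> t \<and> t < 1 / 2"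
    by (rule translate_into_cell[of x1 x2 True])
  then have t: "- 1 / 2 < t" "t \<le> 1 / 2" by simp_all
  have st: "\<bar>s\<bar> \<le> 1 / 2" "\<bar>t\<bar> \<le> 1 / 2" using b(4,5) t by linarith+
  have "\<bar>s + t * \<omega>\<bar> < (1 + \<omega>) / 2"
  proof (cases "s = - 1 / 2 \<and> t = 1 / 2")
    case True
    then have e: "s + t * \<omega> = (\<omega> - 1) / 2" by (simp add: diff_divide_distrib)
    show ?thesis unfolding e using omega_pos by (simp add: abs_less_iff field_simps)
  next
    case False
    then have "\<bar>s\<bar> < 1 / 2 \<or> \<bar>t\<bar> < 1 / 2" using b(4,5) t by linarith
    then show ?thesis using cell_bound[OF st] by blast
  qed
  then show thesis using that[OF b(1)] b(2,3) cell_bound[OF st] by simp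
qed

text \<open>In this cell the corner \<open>s = t = - 1 / 2\<close> is the only point at which one of the bounds
  can be attained.\<close>

lemma translate_strict_or_corner:
  obtains \<beta> where "\<beta> \<in> R" "\<bar>x1 + \<beta>\<bar> < (1 + \<omega>) / 2" "\<bar>x2 + cj \<beta>\<bar> < (1 - cj \<omega>) / 2"
  | \<beta> where "\<beta> \<in> R" "x1 + \<beta> = - (1 + \<omega>) / 2" "x2 + cj \<beta> = - (1 + cj \<omega>) / 2"
proof -
  obtain \<beta> s t where b: "\<beta> \<in> R" "x1 + \<beta> = s + t * \<omega>" "x2 + cj \<beta> = s + t * cj \<omega>"
     "- 1 / 2 \<le> s" "s < 1 / 2" "if False then - 1 / 2 < t \<and> t \<le> 1 / 2 else - 1 / 2 \<le> t \<and> t < 1 / 2"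
    by (rule translate_into_cell[of x1 x2 False])
  then have t: "- 1 / 2 \<le> t" "t < 1 / 2" by simp_all
  have st: "\<bar>s\<bar> \<le> 1 / 2" "\<bar>t\<bar> \<le> 1 / 2" using b(4,5) t by linarith+
  show thesis
  proof (cases "s = - 1 / 2 \<and> t = - 1 / 2")
    case True
    have "s + t * \<omega> = - (1 + \<omega>) / 2" "s + t * cj \<omega> = - (1 + cj \<omega>) / 2"
      unfolding conjunct1[OF True] conjunct2[OF True] by (simp_all add: field_simps)
    then show thesis using that(2)[OF b(1)] b(2,3) by metis
  next
    case False
    then have "\<bar>s\<bar> < 1 / 2 \<or> \<bar>t\<bar> < 1 / 2" using b(4,5) t by linarith
    then show thesis using cell_bound(3)[OF st] that(1)[OF b(1)] b(2,3) by auto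
  qed
qed

lemma translate_strict_second:
  obtains \<beta> where "\<beta> \<in> R" "\<bar>x1 + \<beta>\<bar> \<le> (1 + \<omega>) / 2" "\<bar>x2 + cj \<beta>\<bar> < (1 - cj \<omega>) / 2"
proof (rule translate_strict_or_corner[of x1 x2])
  fix \<beta> assume b: "\<beta> \<in> R" "\<bar>x1 + \<beta>\<bar> < (1 + \<omega>) / 2" "\<bar>x2 + cj \<beta>\<bar> < (1 - cj \<omega>) / 2"
  then show thesis using that[OF b(1)] by simp
next
  fix \<beta> assume b: "\<beta> \<in> R" "x1 + \<beta> = - (1 + \<omega>) / 2" "x2 + cj \<beta> = - (1 + cj \<omega>) / 2"
  have "\<bar>- (1 + \<omega>) / 2\<bar> \<le> (1 + \<omega>) / 2" using omega_pos by simp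
  moreover have "\<bar>- (1 + cj \<omega>) / 2\<bar> < (1 - cj \<omega>) / 2" using conj_omega_neg by (simp add: abs_less_iff field_simps)
  ultimately show thesis using that[OF b(1)] unfolding b(2,3) by blast
qed

text \<open>Multiplying \<open>u\<close> by the fundamental unit multiplies the quotient of \<open>u\<^sup>2 y1\<close> and
  \<open>u'\<^sup>2 y2\<close> by the fourth power of that unit. Rounding a logarithm therefore finds a
  quotient between its inverse square and its square.\<close>

lemma balancing_unit:
  assumes "0 < y1" "0 < y2"
  obtains u where "u \<in> Units (quad_ring k)"
    "u\<^sup>2 * y1 \<le> eps\<^sup>2 * ((cj u)\<^sup>2 * y2)" "(cj u)\<^sup>2 * y2 \<le> eps\<^sup>2 * (u\<^sup>2 * y1)"
proof -
  define m where "m = round (- (ln y1 - ln y2) / (4 * ln eps))"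
  define u where "u = exp (of_int m * ln eps)"
  have e: "0 < ln eps" "0 < eps" using fund_unit_props by auto
  have pow: "exp (real n * ln eps) = eps ^ n" for n using e by (simp add: exp_of_nat_mult)
  have u: "u \<in> Units (quad_ring k)"
  proof (cases m)
    case (nonneg n)
    then show ?thesis using pow unit_power[OF fund_unit_props(1)] by (simp add: u_def)
  next
    case (neg n)
    then have "of_int m = - real (Suc n)" by simp
    then have "u = inverse (exp (real (Suc n) * ln eps))"
      unfolding u_def by (simp only: mult_minus_left exp_minus)
    then show ?thesis using pow unit_power[OF fund_unit_props(1)] unit_inverse(1) by metis
  qed
  have "0 < u" by (simp add: u_def)
  then have cu: "\<bar>cj u\<bar> = inverse u" using norm_unit[OF u] by (simp add: inverse_unique)
  have "ln (u\<^sup>2 * y1) - ln ((cj u)\<^sup>2 * y2) = 4 * of_int m * ln eps + (ln y1 - ln y2)"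
  proof -
    have "(cj u)\<^sup>2 = (inverse u)\<^sup>2" using cu by (metis power2_abs)
    then show ?thesis using assms \<open>0 < u\<close>
      by (simp add: ln_mult ln_realpow ln_inverse power_inverse) (simp add: u_def)
  qed
  moreover have rescale: "(M - - A / (4 * l)) * (4 * l) = 4 * M * l + A" if "l \<noteq> 0" for l M A :: real
    using that by (simp add: field_simps)
  have "\<bar>of_int m - - (ln y1 - ln y2) / (4 * ln eps)\<bar> \<le> 1 / 2"
    unfolding m_def by (rule of_int_round_abs_le)
  then have "\<bar>of_int m - - (ln y1 - ln y2) / (4 * ln eps)\<bar> * (4 * ln eps) \<le> 1 / 2 * (4 * ln eps)"
    using e by (intro mult_right_mono) auto
  then have "\<bar>(of_int m - - (ln y1 - ln y2) / (4 * ln eps)) * (4 * ln eps)\<bar> \<le> 2 * ln eps"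
    using e by (simp add: abs_mult)
  then have "\<bar>4 * of_int m * ln eps + (ln y1 - ln y2)\<bar> \<le> 2 * ln eps"
    using rescale[of "ln eps" "of_int m" "ln y1 - ln y2"] e by simp
  ultimately have "ln (u\<^sup>2 * y1) \<le> 2 * ln eps + ln ((cj u)\<^sup>2 * y2)"
     "ln ((cj u)\<^sup>2 * y2) \<le> 2 * ln eps + ln (u\<^sup>2 * y1)" by linarith+
  moreover have ln_eps: "ln (eps\<^sup>2 * X) = 2 * ln eps + ln X" if "0 < X" for X
    using that e ln_mult[of "eps\<^sup>2" X] by (simp add: ln_realpow)
  have pos: "0 < u\<^sup>2 * y1" "0 < (cj u)\<^sup>2 * y2"
    using \<open>0 < u\<close> assms cu by (auto simp: zero_less_mult_iff)
  ultimately have "ln (u\<^sup>2 * y1) \<le> ln (eps\<^sup>2 * ((cj u)\<^sup>2 * y2))" "ln ((cj u)\<^sup>2 * y2) \<le> ln (eps\<^sup>2 * (u\<^sup>2 * y1))"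
    using ln_eps by simp_all
  then show thesis using that[OF u] pos e by simp
qed

text \<open>The one configuration in which no translation makes both inequalities strict. There
  the norm of \<open>c\<close> is \<open>\<plusminus>2 k / k0\<^sup>2\<close>, which excludes \<open>k0 = 2\<close>, as \<open>k\<close> is odd then and the norm
  an integer. Now \<open>2 x1\<close> and its conjugate \<open>2 x2\<close> lie in \<open>R\<close>, so a row with first entry \<open>2\<close>
  forces \<open>y1 y2 \<ge> 1 / 4\<close>, that is \<open>k = 2\<close>. But then already \<open>\<surd>2 x1\<close> and its conjugate
  \<open>- \<surd>2 x2\<close> lie in \<open>R\<close>, which forces \<open>y1 y2 \<ge> 1 / 2\<close>.\<close>

lemma no_corner_at_minimal_height:
  assumes Z: "cusp_highest x1 y1 x2 y2"
    and N: "c \<in> R" "\<bar>c * cj c\<bar> = 2 * of_int k / (k0 k)\<^sup>2"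
    and h: "y1 * y2 \<le> (k0 k)\<^sup>2 / (2 * of_int k)"
    and \<beta>: "\<beta> \<in> R" "x1 + \<beta> = - (1 + \<omega>) / 2" "x2 + cj \<beta> = - (1 + cj \<omega>) / 2"
  shows False
proof -
  have M: "1 \<le> cocycle_sq x1 y1 c d * cocycle_sq x2 y2 (cj c) (cj d)" if "c \<in> R" "d \<in> R" "c \<noteq> 0" for c d
    using Z that by (auto simp: cusp_highest_def)
  have "k0 k = 1"
  proof (rule ccontr)
    assume "k0 k \<noteq> 1"
    then have k: "k0 k = 2" "k mod 4 = 1" using k0_cases by auto
    obtain n where "c * cj c = of_int n" using norm_is_int[OF N(1)] by (auto elim: Ints_cases)
    then have "of_int (2 * \<bar>n\<bar>) = (of_int k :: real)" using N(2) k by simp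
    then have "2 * \<bar>n\<bar> = k" by (simp only: of_int_eq_iff)
    then show False using k(2) by presburger
  qed
  then have h': "y1 * y2 \<le> 1 / (2 * of_int k)" and om: "\<omega> = 1 + sqrt (of_int k)" "cj \<omega> = 1 - sqrt (of_int k)"
    using h unfolding conj_omega by (simp_all add: omega_def)
  have x: "x1 = - \<beta> - (1 + \<omega>) / 2" "x2 = - cj \<beta> - (1 + cj \<omega>) / 2" using \<beta> by (simp_all add: field_simps)
  have "0 < y1 * y2" using Z by (auto simp: cusp_highest_def)
  have z2: "2 * x1 + (2 * \<beta> + 1 + \<omega>) = 0" "2 * x2 + (2 * cj \<beta> + 1 + cj \<omega>) = 0"
    unfolding x by (simp_all add: field_simps)
  have "1 \<le> cocycle_sq x1 y1 2 (2 * \<beta> + 1 + \<omega>) * cocycle_sq x2 y2 2 (2 * cj \<beta> + 1 + cj \<omega>)"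
    using M[of "of_int 2" "2 * \<beta> + 1 + \<omega>"] \<beta>(1) R_ints[of 2] conj_int[of 2] by simp
  also have "\<dots> = 16 * (y1 * y2)\<^sup>2"
    unfolding cocycle_sq_def z2 by (simp add: power_mult_distrib)
  finally have "1\<^sup>2 \<le> (4 * (y1 * y2))\<^sup>2" by (simp add: power_mult_distrib)
  then have "1 \<le> 4 * (y1 * y2)" using \<open>0 < y1 * y2\<close> power2_le_imp_le[of 1 "4 * (y1 * y2)"] by simp
  also have "\<dots> \<le> 4 * (1 / (2 * of_int k))" using h' by linarith
  finally have "k \<le> 2" using k_gt_1 by (simp add: field_simps)
  then have k2: "k = 2" using k_gt_1 by simp
  have "cj (\<omega> - 1) = cj \<omega> - 1" by simp
  then have "\<omega> - 1 = sqrt (of_int k)" "cj (\<omega> - 1) = - sqrt (of_int k)" using om by linarith+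
  then have s: "\<omega> - 1 = sqrt 2" "cj (\<omega> - 1) = - sqrt 2" unfolding k2 by simp_all
  define d where "d = (\<omega> - 1) * \<beta> + \<omega>"
  have om': "\<omega> = sqrt 2 + 1" "cj \<omega> = - sqrt 2 + 1" using om unfolding k2 by simp_all
  have d: "d \<in> R" "d = sqrt 2 * \<beta> + sqrt 2 + 1" "cj d = - sqrt 2 * cj \<beta> - sqrt 2 + 1"
  proof -
    show "d \<in> R" using \<beta>(1) by (simp add: d_def)
    show "d = sqrt 2 * \<beta> + sqrt 2 + 1" unfolding d_def s(1) om'(1) by simp
    have "cj d = cj (\<omega> - 1) * cj \<beta> + cj \<omega>" using \<beta>(1) by (simp add: d_def)
    then show "cj d = - sqrt 2 * cj \<beta> - sqrt 2 + 1" unfolding s(2) om'(2) by simp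
  qed
  have z: "sqrt 2 * x1 + d = 0" "- sqrt 2 * x2 + cj d = 0"
  proof -
    show "sqrt 2 * x1 + d = 0"
      unfolding x(1) d(2) om'(1) by (simp add: algebra_simps add_divide_distrib)
    show "- sqrt 2 * x2 + cj d = 0"
      unfolding x(2) d(3) om'(2) by (simp add: algebra_simps add_divide_distrib diff_divide_distrib)
  qed
  have "1 \<le> cocycle_sq x1 y1 (sqrt 2) d * cocycle_sq x2 y2 (- sqrt 2) (cj d)"
    using M[OF R_closed(3)[OF omega_in_R R_closed'(2)] d(1)] unfolding s(2) unfolding s(1) by simp
  also have "\<dots> = 4 * (y1 * y2)\<^sup>2"
    unfolding cocycle_sq_def z by (simp add: power_mult_distrib)
  finally have "1\<^sup>2 \<le> (2 * (y1 * y2))\<^sup>2" by (simp add: power_mult_distrib)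
  then have "1 \<le> 2 * (y1 * y2)" using \<open>0 < y1 * y2\<close> power2_le_imp_le[of 1 "2 * (y1 * y2)"] by simp
  then show False using h' k2 by simp
qed

text \<open>Used for the distance \<open>X\<close> of the real part of \<open>z1\<close> from \<open>- d / c\<close>, or of \<open>z2\<close> from
  \<open>- d' / c'\<close>, with the square root \<open>sqrt E\<close> from the definition of \<open>couples\<close>.\<close>

lemma offset_bound:
  fixes X E e y y' :: real
  assumes "0 < y" "0 < y'" "1 < e" "0 \<le> E" and X: "X\<^sup>2 * y'\<^sup>2 \<le> E * (y * y')" and y: "y \<le> e\<^sup>2 * y'"
  shows "\<bar>X\<bar> \<le> e * sqrt E" and "0 < E \<Longrightarrow> y < e\<^sup>2 * y' \<Longrightarrow> \<bar>X\<bar> < e * sqrt E"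
proof -
  have root: "sqrt (E * e\<^sup>2) = e * sqrt E" using assms by (simp add: real_sqrt_mult mult.commute)
  have rearrange: "E * ((e\<^sup>2 * y') * y') = (E * e\<^sup>2) * y'\<^sup>2" by (simp add: power2_eq_square algebra_simps)
  have "E * (y * y') \<le> E * ((e\<^sup>2 * y') * y')" using assms by (intro mult_left_mono mult_right_mono) auto
  then have "X\<^sup>2 * y'\<^sup>2 \<le> (E * e\<^sup>2) * y'\<^sup>2" using X rearrange by linarith
  then have "X\<^sup>2 \<le> E * e\<^sup>2" using \<open>0 < y'\<close> by simp
  then have "\<bar>X\<bar> \<le> sqrt (E * e\<^sup>2)" by (simp add: real_le_rsqrt)
  then show "\<bar>X\<bar> \<le> e * sqrt E" by (simp only: root)
  assume s: "0 < E" "y < e\<^sup>2 * y'"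
  then have "E * (y * y') < E * ((e\<^sup>2 * y') * y')" using \<open>0 < y'\<close> by (intro mult_strict_left_mono mult_strict_right_mono) auto
  then have "X\<^sup>2 * y'\<^sup>2 < (E * e\<^sup>2) * y'\<^sup>2" using X rearrange by linarith
  then have "X\<^sup>2 < E * e\<^sup>2" using \<open>0 < y'\<close> by simp
  then have "\<bar>X\<bar> < sqrt (E * e\<^sup>2)" by (simp add: real_less_rsqrt)
  then show "\<bar>X\<bar> < e * sqrt E" by (simp only: root)
qed

text \<open>The assumption \<open>eq\<close> reads \<open>(X1\<^sup>2 + y1\<^sup>2) (X2\<^sup>2 + y2\<^sup>2) \<le> 1 / N\<^sup>2\<close>, where \<open>N\<close> is the
  norm of \<open>c\<close> and \<open>X1\<close>, \<open>X2\<close> are the differences between the real parts and \<open>- d / c\<close> and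
  \<open>- d' / c'\<close>. Expanding the product and inserting the lower bound \<open>h0\<close> for \<open>h = y1 y2\<close>
  gives all bounds up to strictness. If \<open>E > 0\<close>, one of the two balance conditions is
  strict, which makes the bound on \<open>X1\<close> or on \<open>X2\<close> strict, and a suitable translation makes
  the other sum strict. If \<open>E = 0\<close>, then \<open>h = h0\<close> and only corners of the cell are a
  problem.\<close>

lemma balanced_neighbour_bounds:
  assumes Z: "cusp_highest x1 y1 x2 y2"
    and c: "c \<in> R" "c \<noteq> 0" "d \<in> R"
    and eq: "cocycle_sq x1 y1 c d * cocycle_sq x2 y2 (cj c) (cj d) \<le> 1"
    and bal: "y1 \<le> eps\<^sup>2 * y2" "y2 \<le> eps\<^sup>2 * y1"
  shows "\<bar>quad_norm k c\<bar> \<le> 2 * of_int k / (k0 k)\<^sup>2"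
    and "\<exists>\<beta>\<in>R. \<bar>(d - c * \<beta>) / c\<bar> < eps * bound_sqrt k c + (1 + \<omega>) / 2 \<and>
           \<bar>cj (d - c * \<beta>) / cj c\<bar> < eps * bound_sqrt k c + (1 - cj \<omega>) / 2"
proof -
  have y: "0 < y1" "0 < y2" using Z by (auto simp: cusp_highest_def)
  have eps: "1 < eps" by (rule fund_unit_props)
  define h0 where "h0 = (k0 k)\<^sup>2 / (2 * of_int k)"
  define h where "h = y1 * y2"
  define N where "N = c * cj c"
  have h0: "0 < h0" "h0 \<le> h" "1 / h0 = 2 * of_int k / (k0 k)\<^sup>2"
    using k0_Rats k_gt_1 height_lower_bound[OF Z] by (auto simp: h0_def h_def)
  have "0 < h" using h0 by linarith
  have N: "N \<noteq> 0" "0 < N\<^sup>2" using c by (auto simp: N_def)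
  define X1 X2 where "X1 = x1 + d / c" and "X2 = x2 + cj d / cj c"
  have cc: "cj c \<noteq> 0" using c by simp
  have fac: "cocycle_sq x1 y1 c d = c\<^sup>2 * (X1\<^sup>2 + y1\<^sup>2)" "cocycle_sq x2 y2 (cj c) (cj d) = (cj c)\<^sup>2 * (X2\<^sup>2 + y2\<^sup>2)"
    using c cc by (simp_all add: cocycle_sq_def X1_def X2_def power2_eq_square field_simps)
  have "N\<^sup>2 * ((X1\<^sup>2 + y1\<^sup>2) * (X2\<^sup>2 + y2\<^sup>2)) \<le> 1"
    using eq unfolding fac N_def by (simp add: power_mult_distrib algebra_simps)
  then have prod: "(X1\<^sup>2 + y1\<^sup>2) * (X2\<^sup>2 + y2\<^sup>2) \<le> 1 / N\<^sup>2"
    using N by (simp add: field_simps)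
  have expand: "(X1\<^sup>2 + y1\<^sup>2) * (X2\<^sup>2 + y2\<^sup>2) = X1\<^sup>2 * X2\<^sup>2 + X1\<^sup>2 * y2\<^sup>2 + X2\<^sup>2 * y1\<^sup>2 + h\<^sup>2"
    by (simp add: h_def power2_eq_square algebra_simps)
  define G where "G = 1 / N\<^sup>2 - h\<^sup>2"
  have nn: "0 \<le> X1\<^sup>2 * X2\<^sup>2" "0 \<le> X1\<^sup>2 * y2\<^sup>2" "0 \<le> X2\<^sup>2 * y1\<^sup>2" by simp_all
  have G: "0 \<le> G" "X1\<^sup>2 * y2\<^sup>2 \<le> G" "X2\<^sup>2 * y1\<^sup>2 \<le> G"
    using prod nn unfolding expand G_def by linarith+
  define E where "E = 1 / (N\<^sup>2 * h0) - h0"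
  have "1 / (N\<^sup>2 * h) \<le> 1 / (N\<^sup>2 * h0)" using h0 N by (intro divide_left_mono) auto
  then have "G / h \<le> E" using h0 \<open>0 < h\<close> unfolding G_def E_def
    by (simp add: diff_divide_distrib power2_eq_square)
  then have "G \<le> E * h" using \<open>0 < h\<close> by (simp add: field_simps)
  then have "0 \<le> E * h" using G(1) by linarith
  then have GE: "G \<le> E * h" "0 \<le> E" using \<open>G \<le> E * h\<close> \<open>0 < h\<close> by (auto simp: zero_le_mult_iff)
  have "N\<^sup>2 * h\<^sup>2 \<le> 1" using G(1) N by (simp add: G_def field_simps)
  then have "(\<bar>N\<bar> * h)\<^sup>2 \<le> 1\<^sup>2" by (simp add: power_mult_distrib)
  then have Nh: "\<bar>N\<bar> * h \<le> 1" by (rule power2_le_imp_le) simp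
  have "\<bar>N\<bar> * h0 \<le> \<bar>N\<bar> * h" using h0 by (intro mult_left_mono) auto
  then have "\<bar>N\<bar> \<le> 1 / h0" using Nh h0 by (simp add: field_simps)
  then show "\<bar>quad_norm k c\<bar> \<le> 2 * of_int k / (k0 k)\<^sup>2"
    using h0(3) by (simp add: N_def quad_norm_def)
  have bs: "bound_sqrt k c = sqrt E"
    unfolding bound_sqrt_def E_def quad_norm_def N_def[symmetric] h0_def
    using k_gt_1 k0_Rats by (simp add: field_simps)
  have "X1\<^sup>2 * y2\<^sup>2 \<le> E * (y1 * y2)" using G(2) GE(1) by (simp add: h_def)
  note X1 = offset_bound[OF y eps GE(2) this bal(1)]
  have "X2\<^sup>2 * y1\<^sup>2 \<le> E * (y2 * y1)" using G(3) GE(1) by (simp add: h_def mult.commute)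
  note X2 = offset_bound[OF y(2,1) eps GE(2) this bal(2)]
  have split: "(d - c * \<beta>) / c = X1 - (x1 + \<beta>)" "cj (d - c * \<beta>) / cj c = X2 - (x2 + cj \<beta>)" if "\<beta> \<in> R" for \<beta>
    using c cc that by (simp_all add: X1_def X2_def field_simps)
  have sum: "\<bar>(d - c * \<beta>) / c\<bar> < eps * bound_sqrt k c + (1 + \<omega>) / 2 \<and>
           \<bar>cj (d - c * \<beta>) / cj c\<bar> < eps * bound_sqrt k c + (1 - cj \<omega>) / 2"
    if "\<beta> \<in> R" "\<bar>x1 + \<beta>\<bar> \<le> (1 + \<omega>) / 2" "\<bar>x2 + cj \<beta>\<bar> \<le> (1 - cj \<omega>) / 2"
      "\<bar>X1\<bar> < eps * sqrt E \<or> \<bar>x1 + \<beta>\<bar> < (1 + \<omega>) / 2"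
      "\<bar>X2\<bar> < eps * sqrt E \<or> \<bar>x2 + cj \<beta>\<bar> < (1 - cj \<omega>) / 2" for \<beta>
    using that X1(1) X2(1) unfolding split[OF that(1)] bs by linarith
  show "\<exists>\<beta>\<in>R. \<bar>(d - c * \<beta>) / c\<bar> < eps * bound_sqrt k c + (1 + \<omega>) / 2 \<and>
           \<bar>cj (d - c * \<beta>) / cj c\<bar> < eps * bound_sqrt k c + (1 - cj \<omega>) / 2"
  proof (cases "0 < E")
    case True
    show ?thesis
    proof (cases "y1 < eps\<^sup>2 * y2")
      case y1: True
      obtain \<beta> where "\<beta> \<in> R" "\<bar>x1 + \<beta>\<bar> \<le> (1 + \<omega>) / 2" "\<bar>x2 + cj \<beta>\<bar> < (1 - cj \<omega>) / 2"
        using translate_strict_second by blast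
      then show ?thesis using sum[of \<beta>] X1(2)[OF True y1] by auto
    next
      case False
      then have "y1 = eps\<^sup>2 * y2" using bal by simp
      then have "y2 < eps\<^sup>2 * y1" using y eps
      proof -
        have "1 * 1 < eps\<^sup>2 * eps\<^sup>2" using eps by (intro mult_strict_mono one_less_power) auto
        then have "1 * y2 < (eps\<^sup>2 * eps\<^sup>2) * y2" using y by (intro mult_strict_right_mono) auto
        then show ?thesis using \<open>y1 = eps\<^sup>2 * y2\<close> by (simp add: mult.assoc)
      qed
      obtain \<beta> where "\<beta> \<in> R" "\<bar>x1 + \<beta>\<bar> < (1 + \<omega>) / 2" "\<bar>x2 + cj \<beta>\<bar> \<le> (1 - cj \<omega>) / 2"
        using translate_strict_first by blast
      then show ?thesis using sum[of \<beta>] X2(2)[OF True \<open>y2 < eps\<^sup>2 * y1\<close>] by auto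
    qed
  next
    case False
    then have "E = 0" using GE by simp
    then have "(\<bar>N\<bar> * h0)\<^sup>2 = 1\<^sup>2" using N h0 by (simp add: E_def power2_eq_square field_simps)
    then have Nh0: "\<bar>N\<bar> * h0 = 1" using h0 by (subst (asm) power2_eq_iff_nonneg) auto
    then have "\<bar>N\<bar> = 1 / h0" using h0 by (simp add: field_simps)
    moreover have "\<bar>N\<bar> * h \<le> \<bar>N\<bar> * h0" using Nh Nh0 by simp
    then have "h \<le> h0" using N by simp
    ultimately have no_corner: "\<not> (\<beta> \<in> R \<and> x1 + \<beta> = - (1 + \<omega>) / 2 \<and> x2 + cj \<beta> = - (1 + cj \<omega>) / 2)" for \<beta>
      using no_corner_at_minimal_height[OF Z c(1), of \<beta>] h0(3) unfolding N_def h_def h0_def by auto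
    obtain \<beta> where "\<beta> \<in> R" "\<bar>x1 + \<beta>\<bar> < (1 + \<omega>) / 2" "\<bar>x2 + cj \<beta>\<bar> < (1 - cj \<omega>) / 2"
      using translate_strict_or_corner[of x1 x2] no_corner by metis
    then show ?thesis using sum[of \<beta>] by auto
  qed
qed

text \<open>The diagonal matrix of a unit \<open>u\<close> sends \<open>z1\<close> to \<open>u\<^sup>2 z1\<close> and \<open>z2\<close> to \<open>u'\<^sup>2 z2\<close>; a
  suitable one reduces to the balanced case.\<close>

lemma neighbour_bounds:
  assumes Z: "cusp_highest x1 y1 x2 y2"
    and c: "c \<in> R" "c \<noteq> 0" "d \<in> R"
    and eq: "cocycle_sq x1 y1 c d * cocycle_sq x2 y2 (cj c) (cj d) \<le> 1"
  obtains u \<beta> where "u \<in> Units (quad_ring k)" "\<beta> \<in> R"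
    "\<bar>quad_norm k (c * inverse u)\<bar> \<le> 2 * of_int k / (k0 k)\<^sup>2"
    "\<bar>(d * u - c * inverse u * \<beta>) / (c * inverse u)\<bar> < eps * bound_sqrt k (c * inverse u) + (1 + \<omega>) / 2"
    "\<bar>cj (d * u - c * inverse u * \<beta>) / cj (c * inverse u)\<bar> < eps * bound_sqrt k (c * inverse u) + (1 - cj \<omega>) / 2"
proof -
  have y: "0 < y1" "0 < y2" using Z by (auto simp: cusp_highest_def)
  obtain u where u: "u \<in> Units (quad_ring k)"
    "u\<^sup>2 * y1 \<le> eps\<^sup>2 * ((cj u)\<^sup>2 * y2)" "(cj u)\<^sup>2 * y2 \<le> eps\<^sup>2 * (u\<^sup>2 * y1)"
    using balancing_unit[OF y] by blast
  note uR = unit_inverse(2,3)[OF u(1)]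
  have u0: "u \<noteq> 0" "cj u \<noteq> 0" using unit_nonzero[OF u(1)] uR by auto
  have uu: "u\<^sup>2 * (cj u)\<^sup>2 = 1"
    using norm_unit[OF u(1)] by (metis abs_mult power2_abs power_mult_distrib power_one)
  have scale: "cocycle_sq (u\<^sup>2 * x1) (u\<^sup>2 * y1) c d * cocycle_sq ((cj u)\<^sup>2 * x2) ((cj u)\<^sup>2 * y2) (cj c) (cj d)
      = cocycle_sq x1 y1 (c * u) (d * inverse u) * cocycle_sq x2 y2 (cj (c * u)) (cj (d * inverse u))"
    if "c \<in> R" "d \<in> R" for c d
  proof -
    have "cocycle_sq (u\<^sup>2 * x1) (u\<^sup>2 * y1) c d * cocycle_sq ((cj u)\<^sup>2 * x2) ((cj u)\<^sup>2 * y2) (cj c) (cj d)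
       = (u\<^sup>2 * (cj u)\<^sup>2) * (cocycle_sq x1 y1 (c * u) (d * inverse u) * cocycle_sq x2 y2 (cj (c * u)) (cj (d * inverse u)))"
      unfolding cocycle_sq_scale[OF u0(1)] cocycle_sq_scale[OF u0(2)]
      using that uR by (simp add: conj_unit_inverse[OF u(1)] divide_inverse)
    then show ?thesis using uu by simp
  qed
  have "cusp_highest (u\<^sup>2 * x1) (u\<^sup>2 * y1) ((cj u)\<^sup>2 * x2) ((cj u)\<^sup>2 * y2)"
    unfolding cusp_highest_def
  proof (intro conjI ballI impI)
    fix c d assume cd: "c \<in> R" "d \<in> R" "(c, d) \<noteq> (0, 0)"
    then have "(c * u, d * inverse u) \<noteq> (0, 0)" using u0 by simp
    then show "1 \<le> cocycle_sq (u\<^sup>2 * x1) (u\<^sup>2 * y1) c d * cocycle_sq ((cj u)\<^sup>2 * x2) ((cj u)\<^sup>2 * y2) (cj c) (cj d)"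
      unfolding scale[OF cd(1,2)] using Z cd uR unfolding cusp_highest_def by blast
  qed (use y u0 in auto)
  moreover have "c * inverse u \<in> R" "c * inverse u \<noteq> 0" "d * u \<in> R" using c uR u0 by auto
  moreover have "cocycle_sq (u\<^sup>2 * x1) (u\<^sup>2 * y1) (c * inverse u) (d * u) *
      cocycle_sq ((cj u)\<^sup>2 * x2) ((cj u)\<^sup>2 * y2) (cj (c * inverse u)) (cj (d * u)) \<le> 1"
    using eq c uR u0 by (subst scale) (auto simp: mult.assoc)
  ultimately show thesis
    using balanced_neighbour_bounds[of "u\<^sup>2 * x1" "u\<^sup>2 * y1" "(cj u)\<^sup>2 * x2" "(cj u)\<^sup>2 * y2" "c * inverse u" "d * u"] u that[OF u(1)]
    by blast
qed

end

section \<open>Positive definite binary forms\<close>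

text \<open>Forms are kept as functions, so that substitution is composition and convex
  combinations are pointwise.\<close>

definition posdef :: "(real \<Rightarrow> real \<Rightarrow> real) \<Rightarrow> bool" where
  "posdef f \<longleftrightarrow> (\<exists>p q r. \<forall>c d. f c d = p * c\<^sup>2 + 2 * q * c * d + r * d\<^sup>2) \<and>
     (\<forall>c d. (c, d) \<noteq> (0, 0) \<longrightarrow> 0 < f c d)"

lemma posdef_pos: "posdef f \<Longrightarrow> (c, d) \<noteq> (0, 0) \<Longrightarrow> 0 < f c d"
  unfolding posdef_def by blast

lemma posdef_nonneg: "posdef f \<Longrightarrow> 0 \<le> f c d"
  unfolding posdef_def by (cases "(c, d) = (0, 0)") (auto simp: less_imp_le)

lemma posdef_homogeneous: "posdef f \<Longrightarrow> f (u * c) (u * d) = u\<^sup>2 * f c d"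
  unfolding posdef_def by (auto simp: power2_eq_square algebra_simps)

lemma posdef_sum_squares: "posdef (\<lambda>c d. c\<^sup>2 + d\<^sup>2)"
proof -
  have "\<exists>p q r :: real. \<forall>c d. c\<^sup>2 + d\<^sup>2 = p * c\<^sup>2 + 2 * q * c * d + r * d\<^sup>2"
    by (rule exI[of _ 1], rule exI[of _ 0], rule exI[of _ 1]) simp
  then show ?thesis unfolding posdef_def by (auto simp: sum_power2_gt_zero_iff)
qed

lemma posdef_coeffs:
  assumes "posdef f"
  obtains p q r where "\<And>c d. f c d = p * c\<^sup>2 + 2 * q * c * d + r * d\<^sup>2" "0 < p" "0 < r" "0 < p * r - q\<^sup>2"
proof -
  obtain p q r where f: "\<And>c d. f c d = p * c\<^sup>2 + 2 * q * c * d + r * d\<^sup>2"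
    using assms unfolding posdef_def by blast
  have "0 < p" "0 < r" using posdef_pos[OF assms, of 1 0] posdef_pos[OF assms, of 0 1] by (simp_all add: f)
  moreover have "f r (- q) = r * (p * r - q\<^sup>2)" by (simp add: f power2_eq_square algebra_simps)
  then have "0 < r * (p * r - q\<^sup>2)" using posdef_pos[OF assms, of r "- q"] \<open>0 < r\<close> by simp
  then have "0 < p * r - q\<^sup>2" using \<open>0 < r\<close> by (simp add: zero_less_mult_iff)
  ultimately show thesis using that f by blast
qed

text \<open>The roots \<open>d / c\<close> of the form are a complex number \<open>- z\<close> and its conjugate.\<close>

lemma posdef_point:
  assumes "posdef f"
  obtains x y where "0 < y" "\<And>c d. f c d = f 0 1 * cocycle_sq x y c d"
proof -
  obtain p q r where f: "\<And>c d. f c d = p * c\<^sup>2 + 2 * q * c * d + r * d\<^sup>2" and pos: "0 < p" "0 < r" "0 < p * r - q\<^sup>2"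
    by (rule posdef_coeffs[OF assms]) (rule that)
  define y where "y = sqrt (p * r - q\<^sup>2) / r"
  define t x where "t = p / r" and "x = q / r"
  have pq: "p = t * r" "q = x * r" using pos by (simp_all add: t_def x_def)
  have "y\<^sup>2 = (p * r - q\<^sup>2) / r\<^sup>2" using pos by (simp add: y_def power_divide)
  also have "\<dots> = t - x\<^sup>2" unfolding pq using pos by (simp add: diff_divide_distrib power2_eq_square)
  finally have y2: "y\<^sup>2 = t - x\<^sup>2" .
  have f01: "f 0 1 = r" by (simp add: f)
  have "f c d = f 0 1 * cocycle_sq x y c d" for c d
    unfolding f01 cocycle_sq_def power_mult_distrib y2 unfolding f pq
    by (simp add: power2_eq_square algebra_simps)
  moreover have "0 < y" using pos by (simp add: y_def)
  ultimately show thesis using that by blast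
qed

text \<open>The constant determinant over trace is a lower bound for the smaller eigenvalue.\<close>

lemma posdef_lower_bound:
  assumes "posdef f"
  obtains \<kappa> where "0 < \<kappa>" "\<And>c d. \<kappa> * (c\<^sup>2 + d\<^sup>2) \<le> f c d"
proof -
  obtain p q r where f: "\<And>c d. f c d = p * c\<^sup>2 + 2 * q * c * d + r * d\<^sup>2" and pos: "0 < p" "0 < r" "0 < p * r - q\<^sup>2"
    by (rule posdef_coeffs[OF assms]) (rule that)
  have "(p * r - q\<^sup>2) / (p + r) * (c\<^sup>2 + d\<^sup>2) \<le> f c d" for c d
  proof -
    have "(p + r) * f c d - (p * r - q\<^sup>2) * (c\<^sup>2 + d\<^sup>2) = (p * c + q * d)\<^sup>2 + (q * c + r * d)\<^sup>2"
      by (simp add: f power2_eq_square algebra_simps)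
    then have "(p * r - q\<^sup>2) * (c\<^sup>2 + d\<^sup>2) \<le> (p + r) * f c d"
      using zero_le_power2[of "p * c + q * d"] zero_le_power2[of "q * c + r * d"] by linarith
    then show ?thesis using pos by (simp add: pos_divide_le_eq mult.commute)
  qed
  then show thesis using that[of "(p * r - q\<^sup>2) / (p + r)"] pos by simp
qed

lemma posdef_convex:
  assumes "posdef f" "posdef g" "0 \<le> s" "s \<le> 1"
  shows "posdef (\<lambda>c d. (1 - s) * f c d + s * g c d)"
proof -
  obtain p q r where f: "\<And>c d. f c d = p * c\<^sup>2 + 2 * q * c * d + r * d\<^sup>2" using assms(1) unfolding posdef_def by blast
  obtain p' q' r' where g: "\<And>c d. g c d = p' * c\<^sup>2 + 2 * q' * c * d + r' * d\<^sup>2" using assms(2) unfolding posdef_def by blast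
  have "(1 - s) * f c d + s * g c d = ((1 - s) * p + s * p') * c\<^sup>2 + 2 * ((1 - s) * q + s * q') * c * d
      + ((1 - s) * r + s * r') * d\<^sup>2" for c d
    by (simp add: f g algebra_simps)
  moreover have "0 < (1 - s) * f c d + s * g c d" if "(c, d) \<noteq> (0, 0)" for c d
    using posdef_pos[OF assms(1) that] posdef_pos[OF assms(2) that] assms(3,4)
    by (cases "s = 0") (auto intro: add_nonneg_pos)
  ultimately show ?thesis unfolding posdef_def by blast
qed

definition rowmul :: "real \<times> real \<Rightarrow> real^2^2 \<Rightarrow> real \<times> real" where
  "rowmul v A = (fst v * A $ 1 $ 1 + snd v * A $ 2 $ 1, fst v * A $ 1 $ 2 + snd v * A $ 2 $ 2)"

lemma rowmul_mult: "rowmul (rowmul v A) B = rowmul v (A ** B)"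
  by (simp add: rowmul_def matrix_matrix_mult_def sum_2 algebra_simps)

lemma rowmul_one [simp]: "rowmul v (mat 1) = v"
  by (simp add: rowmul_def mat_def)

lemma rowmul_mat2 [simp]: "rowmul (c, d) (mat2 x y z w) = (c * x + d * z, c * y + d * w)"
  by (simp add: rowmul_def mat2_def)

lemma mat2_mult: "mat2 a b c d ** mat2 a' b' c' d' = mat2 (a * a' + b * c') (a * b' + b * d') (c * a' + d * c') (c * b' + d * d')"
  by (simp add: mat2_def vec_eq_iff forall_2 matrix_matrix_mult_def sum_2)

lemma mat2_collapse: "A = mat2 (A $ 1 $ 1) (A $ 1 $ 2) (A $ 2 $ 1) (A $ 2 $ 2)"
  by (simp add: mat2_def vec_eq_iff forall_2)

lemma det_mat2: "det (mat2 a b c d) = a * d - b * c"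
  by (simp add: mat2_def det_2)

definition subst_form :: "(real \<Rightarrow> real \<Rightarrow> real) \<Rightarrow> real^2^2 \<Rightarrow> real \<Rightarrow> real \<Rightarrow> real" where
  "subst_form f A c d = (case rowmul (c, d) A of (x, y) \<Rightarrow> f x y)"

lemma posdef_subst:
  assumes "posdef f" "det A = 1"
  shows "posdef (subst_form f A)"
proof -
  obtain p q r where f: "\<And>c d. f c d = p * c\<^sup>2 + 2 * q * c * d + r * d\<^sup>2" using assms(1) unfolding posdef_def by blast
  define a b c d where "a = A $ 1 $ 1" and "b = A $ 1 $ 2" and "c = A $ 2 $ 1" and "d = A $ 2 $ 2"
  have det: "a * d - b * c = 1" using assms(2) by (simp add: det_2 a_def b_def c_def d_def)
  have sf: "subst_form f A x y = f (x * a + y * c) (x * b + y * d)" for x y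
    by (simp add: subst_form_def rowmul_def a_def b_def c_def d_def)
  have "subst_form f A x y = f a b * x\<^sup>2 + 2 * (p * a * c + q * (a * d + b * c) + r * b * d) * x * y + f c d * y\<^sup>2" for x y
    by (simp add: sf f power2_eq_square algebra_simps)
  moreover have "0 < subst_form f A x y" if "(x, y) \<noteq> (0, 0)" for x y
  proof -
    have "(x * a + y * c) * d - (x * b + y * d) * c = x * (a * d - b * c)"
      "(x * b + y * d) * a - (x * a + y * c) * b = y * (a * d - b * c)"
      by (simp_all add: algebra_simps)
    then have "(x * a + y * c, x * b + y * d) \<noteq> (0, 0)" using that det by auto
    then show ?thesis unfolding sf by (rule posdef_pos[OF assms(1)])
  qed
  ultimately show ?thesis unfolding posdef_def by blast
qed

section \<open>Cusps and their norms\<close>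

context real_quadratic
begin

definition cusps :: "(real \<times> real) set" where
  "cusps = rowmul (0, 1) ` carrier (SL2 k)"

definition conj_mat :: "real^2^2 \<Rightarrow> real^2^2" where
  "conj_mat A = (\<chi> i j. cj (A $ i $ j))"

text \<open>Up to a factor that is the same for all cusps, the reciprocal of the height above the
  cusp \<open>v\<close> of the point given by \<open>(f, g)\<close>.\<close>

definition cusp_norm :: "(real \<Rightarrow> real \<Rightarrow> real) \<Rightarrow> (real \<Rightarrow> real \<Rightarrow> real) \<Rightarrow> real \<times> real \<Rightarrow> real" where
  "cusp_norm f g v = f (fst v) (snd v) * g (cj (fst v)) (cj (snd v))"

definition minimal :: "(real \<Rightarrow> real \<Rightarrow> real) \<Rightarrow> (real \<Rightarrow> real \<Rightarrow> real) \<Rightarrow> real \<times> real \<Rightarrow> bool" where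
  "minimal f g v \<longleftrightarrow> v \<in> cusps \<and> (\<forall>w\<in>cusps. cusp_norm f g v \<le> cusp_norm f g w)"

lemma SL2_mult [simp]: "A \<otimes>\<^bsub>SL2 k\<^esub> B = A ** B" and SL2_one [simp]: "\<one>\<^bsub>SL2 k\<^esub> = mat 1"
  by (simp_all add: SL2_def)

lemma SL2_entries: "A \<in> carrier (SL2 k) \<Longrightarrow> A $ i $ j \<in> R" "A \<in> carrier (SL2 k) \<Longrightarrow> det A = 1"
  by (auto simp: SL2_def)

lemma mat2_in_SL2: "mat2 a b c d \<in> carrier (SL2 k) \<longleftrightarrow> a \<in> R \<and> b \<in> R \<and> c \<in> R \<and> d \<in> R \<and> a * d - b * c = 1"
  unfolding SL2_def by (simp add: det_mat2) (auto simp: mat2_def forall_2)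

lemma SL2_mult_closed: "A \<in> carrier (SL2 k) \<Longrightarrow> B \<in> carrier (SL2 k) \<Longrightarrow> A ** B \<in> carrier (SL2 k)"
  using monoid.m_closed[OF group.is_monoid[OF group_SL2]] by fastforce

lemma SL2_inverse:
  assumes "A \<in> carrier (SL2 k)"
  shows "inv\<^bsub>SL2 k\<^esub> A \<in> carrier (SL2 k)" "A ** inv\<^bsub>SL2 k\<^esub> A = mat 1" "inv\<^bsub>SL2 k\<^esub> A ** A = mat 1"
  using group.inv_closed[OF group_SL2 assms] group.r_inv[OF group_SL2 assms] group.l_inv[OF group_SL2 assms] by auto

lemma cusps_rowmul: "v \<in> cusps \<Longrightarrow> A \<in> carrier (SL2 k) \<Longrightarrow> rowmul v A \<in> cusps"
  unfolding cusps_def by (auto simp: rowmul_mult intro: SL2_mult_closed)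

lemma cusps_iff: "(c, d) \<in> cusps \<longleftrightarrow> c \<in> R \<and> d \<in> R \<and> (\<exists>a\<in>R. \<exists>b\<in>R. a * d - b * c = 1)"
proof
  assume "(c, d) \<in> cusps"
  then obtain A where A: "A \<in> carrier (SL2 k)" "(c, d) = rowmul (0, 1) A" by (auto simp: cusps_def)
  then have "A $ 1 $ 1 * d - A $ 1 $ 2 * c = 1" using SL2_entries(2)[OF A(1)] by (simp add: rowmul_def det_2)
  then show "c \<in> R \<and> d \<in> R \<and> (\<exists>a\<in>R. \<exists>b\<in>R. a * d - b * c = 1)"
    using A SL2_entries(1)[OF A(1)] by (auto simp: rowmul_def)
next
  assume "c \<in> R \<and> d \<in> R \<and> (\<exists>a\<in>R. \<exists>b\<in>R. a * d - b * c = 1)"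
  then obtain a b where "mat2 a b c d \<in> carrier (SL2 k)" unfolding mat2_in_SL2 by blast
  then show "(c, d) \<in> cusps" unfolding cusps_def by (rule rev_image_eqI) simp
qed

lemma cusps_nonzero: "(c, d) \<in> cusps \<Longrightarrow> (c, d) \<noteq> (0, 0)"
  unfolding cusps_iff by auto

lemma cusps_0_1: "(0, 1) \<in> cusps"
  unfolding cusps_iff by (auto intro!: bexI[of _ 1] bexI[of _ 0])

lemma cusps_conj:
  assumes "(c, d) \<in> cusps"
  shows "(cj c, cj d) \<noteq> (0, 0)"
  using cusps_nonzero[OF assms] assms unfolding cusps_iff by auto

lemma cusps_unit_multiple:
  assumes "(c, d) \<in> cusps" "u \<in> Units (quad_ring k)"
  shows "(u * c, u * d) \<in> cusps"
proof -
  obtain a b where ab: "c \<in> R" "d \<in> R" "a \<in> R" "b \<in> R" "a * d - b * c = 1" using assms cusps_iff by auto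
  have "(inverse u * a) * (u * d) - (inverse u * b) * (u * c) = 1"
    using ab(5) unit_nonzero[OF assms(2)] by (simp add: field_simps)
  then show ?thesis using ab unit_inverse[OF assms(2)] unfolding cusps_iff by blast
qed

lemma cusp_norm_unit_multiple:
  assumes "posdef f" "posdef g" "u \<in> Units (quad_ring k)" "c \<in> R" "d \<in> R"
  shows "cusp_norm f g (u * c, u * d) = cusp_norm f g (c, d)"
proof -
  have "u\<^sup>2 * (cj u)\<^sup>2 = 1"
    using norm_unit[OF assms(3)] by (metis abs_mult power2_abs power_mult_distrib power_one)
  moreover have "cusp_norm f g (u * c, u * d) = (u\<^sup>2 * (cj u)\<^sup>2) * cusp_norm f g (c, d)"
    using assms unit_inverse(2)[OF assms(3)] by (simp add: cusp_norm_def posdef_homogeneous)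
  ultimately show ?thesis by simp
qed

lemma cusp_norm_subst:
  assumes "A \<in> carrier (SL2 k)" "v \<in> cusps"
  shows "cusp_norm (subst_form f A) (subst_form g (conj_mat A)) v = cusp_norm f g (rowmul v A)"
proof -
  have "fst v \<in> R" "snd v \<in> R" using assms(2) cusps_iff[of "fst v" "snd v"] by auto
  then show ?thesis
    using SL2_entries(1)[OF assms(1)] by (simp add: cusp_norm_def subst_form_def rowmul_def conj_mat_def)
qed

lemma det_conj_mat: "A \<in> carrier (SL2 k) \<Longrightarrow> det (conj_mat A) = 1"
proof -
  assume A: "A \<in> carrier (SL2 k)"
  have "det (conj_mat A) = cj (det A)"
    using SL2_entries(1)[OF A] by (simp add: det_2 conj_mat_def)
  then show ?thesis using SL2_entries(2)[OF A] by simp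
qed

lemma minimal_subst:
  assumes A: "A \<in> carrier (SL2 k)" and v: "v \<in> cusps" and min: "minimal f g (rowmul v A)"
  shows "minimal (subst_form f A) (subst_form g (conj_mat A)) v"
  unfolding minimal_def
proof (intro conjI ballI v)
  fix w assume "w \<in> cusps"
  then show "cusp_norm (subst_form f A) (subst_form g (conj_mat A)) v \<le> cusp_norm (subst_form f A) (subst_form g (conj_mat A)) w"
    unfolding cusp_norm_subst[OF A v] cusp_norm_subst[OF A \<open>w \<in> cusps\<close>]
    using min cusps_rowmul[OF _ A] unfolding minimal_def by blast
qed

lemma principal_ideal: "PIdl\<^bsub>quad_ring k\<^esub> a = {x * a | x. x \<in> R}"
  by (simp add: cgenideal_def quad_ring_def)

lemma ideal_sum: "PIdl\<^bsub>quad_ring k\<^esub> c <+>\<^bsub>quad_ring k\<^esub> PIdl\<^bsub>quad_ring k\<^esub> d = {x * c + y * d | x y. x \<in> R \<and> y \<in> R}"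
proof -
  have "add (quad_ring k) = (+)" by (simp add: quad_ring_def)
  then show ?thesis by (auto simp: set_add_def' principal_ideal)
qed

lemma cusps_imp_ideal_sum:
  assumes "(c, d) \<in> cusps"
  shows "PIdl\<^bsub>quad_ring k\<^esub> c <+>\<^bsub>quad_ring k\<^esub> PIdl\<^bsub>quad_ring k\<^esub> d = R"
proof -
  obtain a b where ab: "c \<in> R" "d \<in> R" "a \<in> R" "b \<in> R" "a * d - b * c = 1" using assms cusps_iff by auto
  have "z = (- (z * b)) * c + (z * a) * d" for z
  proof -
    have "z = z * (a * d - b * c)" using ab(5) by simp
    then show ?thesis by (simp add: algebra_simps)
  qed
  then show ?thesis unfolding ideal_sum using ab by (auto; metis R_closed(2) R_closed'(3))
qed

text \<open>A generator of the ideal \<open>c R + d R\<close> is a common divisor that can be written as a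
  combination of \<open>c\<close> and \<open>d\<close>.\<close>

lemma multiple_of_cusp:
  assumes pid: "principal_domain (quad_ring k)" and cd: "c \<in> R" "d \<in> R" "(c, d) \<noteq> (0, 0)"
  obtains g c0 d0 where "g \<in> R" "g \<noteq> 0" "(c0, d0) \<in> cusps" "c = g * c0" "d = g * d0"
proof -
  interpret principal_domain "quad_ring k" by (rule pid)
  have "ideal (PIdl\<^bsub>quad_ring k\<^esub> c <+>\<^bsub>quad_ring k\<^esub> PIdl\<^bsub>quad_ring k\<^esub> d) (quad_ring k)"
    using cd by (intro add_ideals cgenideal_ideal)
  then obtain g where g: "g \<in> R"
      "PIdl\<^bsub>quad_ring k\<^esub> c <+>\<^bsub>quad_ring k\<^esub> PIdl\<^bsub>quad_ring k\<^esub> d = PIdl\<^bsub>quad_ring k\<^esub> g"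
    using exists_gen by meson
  have gen: "{x * c + y * d | x y. x \<in> R \<and> y \<in> R} = {x * g | x. x \<in> R}"
    using g(2) unfolding ideal_sum unfolding principal_ideal .
  have "c \<in> {x * c + y * d | x y. x \<in> R \<and> y \<in> R}"
    by (rule CollectI, rule exI[of _ 1], rule exI[of _ 0]) simp
  then obtain c0 where c0: "c0 \<in> R" "c = c0 * g" unfolding gen by blast
  have "d \<in> {x * c + y * d | x y. x \<in> R \<and> y \<in> R}"
    by (rule CollectI, rule exI[of _ 0], rule exI[of _ 1]) simp
  then obtain d0 where d0: "d0 \<in> R" "d = d0 * g" unfolding gen by blast
  have "g \<in> {x * g | x. x \<in> R}"
    by (rule CollectI, rule exI[of _ 1]) simp
  then obtain x y where xy: "x \<in> R" "y \<in> R" "g = x * c + y * d" unfolding gen[symmetric] by blast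
  have "g \<noteq> 0" using c0(2) d0(2) cd(3) by auto
  have "g * (y * d0 - (- x) * c0) = x * (c0 * g) + y * (d0 * g)" by (simp add: algebra_simps)
  also have "\<dots> = g * 1" unfolding c0(2)[symmetric] d0(2)[symmetric] xy(3)[symmetric] by simp
  finally have "g * (y * d0 - (- x) * c0) = g * 1" .
  then have "y * d0 - (- x) * c0 = 1" using \<open>g \<noteq> 0\<close> mult_left_cancel by blast
  then have "(c0, d0) \<in> cusps" unfolding cusps_iff using c0(1) d0(1) xy(1,2) R_closed'(3) by blast
  then show thesis using that[OF g(1) \<open>g \<noteq> 0\<close>] c0(2) d0(2) by (metis mult.commute)
qed

text \<open>The norm of \<open>c\<^sup>2 + d\<^sup>2\<close> is a nonzero integer.\<close>

lemma minimal_sum_squares: "minimal (\<lambda>c d. c\<^sup>2 + d\<^sup>2) (\<lambda>c d. c\<^sup>2 + d\<^sup>2) (0, 1)"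
  unfolding minimal_def
proof (intro conjI ballI cusps_0_1)
  fix w assume "w \<in> cusps"
  then obtain c d where w: "w = (c, d)" "c \<in> R" "d \<in> R" "(c, d) \<noteq> (0, 0)"
    using cusps_iff cusps_nonzero by (metis surj_pair)
  have "c\<^sup>2 + d\<^sup>2 \<in> R" "cj (c\<^sup>2 + d\<^sup>2) = (cj c)\<^sup>2 + (cj d)\<^sup>2" using w by (simp_all add: power2_eq_square)
  moreover have "c\<^sup>2 + d\<^sup>2 \<noteq> 0" using w by (auto simp: sum_power2_eq_zero_iff)
  ultimately have "1 \<le> \<bar>(c\<^sup>2 + d\<^sup>2) * ((cj c)\<^sup>2 + (cj d)\<^sup>2)\<bar>" using norm_ge_1 by metis
  then show "cusp_norm (\<lambda>c d. c\<^sup>2 + d\<^sup>2) (\<lambda>c d. c\<^sup>2 + d\<^sup>2) (0, 1) \<le> cusp_norm (\<lambda>c d. c\<^sup>2 + d\<^sup>2) (\<lambda>c d. c\<^sup>2 + d\<^sup>2) w"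
    by (simp add: cusp_norm_def w(1))
qed

text \<open>A bound on the product of the two lengths bounds neither of them, but multiplication
  by a unit makes them comparable, and then both are bounded.\<close>

lemma finite_bounded_cusps_mod_units:
  obtains \<Phi> where "finite \<Phi>" "\<Phi> \<subseteq> cusps"
    "\<And>c d. (c, d) \<in> cusps \<Longrightarrow> (c\<^sup>2 + d\<^sup>2) * ((cj c)\<^sup>2 + (cj d)\<^sup>2) \<le> C \<Longrightarrow> \<exists>u\<in>Units (quad_ring k). (u * c, u * d) \<in> \<Phi>"
proof -
  define K where "K = 1 + eps\<^sup>2 * \<bar>C\<bar>"
  have "1 \<le> K" by (simp add: K_def)
  define S where "S = {a \<in> R. \<bar>a\<bar> \<le> K \<and> \<bar>cj a\<bar> \<le> K}"
  have root: "\<bar>z\<bar> \<le> K" if "z\<^sup>2 \<le> K" for z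
  proof (rule ccontr)
    assume "\<not> \<bar>z\<bar> \<le> K"
    then have "K * 1 < \<bar>z\<bar> * \<bar>z\<bar>" using \<open>1 \<le> K\<close> by (intro mult_strict_mono) auto
    then show False using that by (simp add: power2_eq_square)
  qed
  have "finite S" unfolding S_def by (rule finite_bounded_R)
  then have "finite (cusps \<inter> S \<times> S)" by simp
  moreover have "\<exists>u\<in>Units (quad_ring k). (u * c, u * d) \<in> cusps \<inter> S \<times> S"
    if cd: "(c, d) \<in> cusps" "(c\<^sup>2 + d\<^sup>2) * ((cj c)\<^sup>2 + (cj d)\<^sup>2) \<le> C" for c d
  proof -
    have R: "c \<in> R" "d \<in> R" using cd cusps_iff by auto
    define Y1 Y2 where "Y1 = c\<^sup>2 + d\<^sup>2" and "Y2 = (cj c)\<^sup>2 + (cj d)\<^sup>2"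
    have pos: "0 < Y1" "0 < Y2"
      using cusps_nonzero[OF cd(1)] cusps_conj[OF cd(1)] unfolding Y1_def Y2_def sum_power2_gt_zero_iff by auto
    obtain u where u: "u \<in> Units (quad_ring k)"
      "u\<^sup>2 * Y1 \<le> eps\<^sup>2 * ((cj u)\<^sup>2 * Y2)" "(cj u)\<^sup>2 * Y2 \<le> eps\<^sup>2 * (u\<^sup>2 * Y1)"
      using balancing_unit[OF pos] by blast
    have "u \<in> R" using unit_inverse[OF u(1)] by blast
    have uu: "u\<^sup>2 * (cj u)\<^sup>2 = 1"
      using norm_unit[OF u(1)] by (metis abs_mult power2_abs power_mult_distrib power_one)
    have prod: "(u\<^sup>2 * Y1) * ((cj u)\<^sup>2 * Y2) \<le> \<bar>C\<bar>"
    proof -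
      have "(u\<^sup>2 * Y1) * ((cj u)\<^sup>2 * Y2) = (u\<^sup>2 * (cj u)\<^sup>2) * (Y1 * Y2)" by simp
      then show ?thesis using cd(2)[folded Y1_def Y2_def] unfolding uu by linarith
    qed
    have bound: "X \<le> K" if "X \<le> eps\<^sup>2 * Y" "X * Y \<le> \<bar>C\<bar>" "0 \<le> X" for X Y
    proof -
      have "X * X \<le> X * (eps\<^sup>2 * Y)" using that by (intro mult_left_mono) auto
      also have "\<dots> = eps\<^sup>2 * (X * Y)" by simp
      also have "\<dots> \<le> eps\<^sup>2 * \<bar>C\<bar>" using that by (intro mult_left_mono) auto
      finally have "X\<^sup>2 \<le> K" by (simp add: K_def power2_eq_square)
      then show ?thesis using root by fastforce
    qed
    have B: "u\<^sup>2 * Y1 \<le> K" "(cj u)\<^sup>2 * Y2 \<le> K"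
      using bound[OF u(2) prod] bound[OF u(3)] prod pos by (simp_all add: mult.commute)
    have "(u * c)\<^sup>2 \<le> u\<^sup>2 * Y1" "(u * d)\<^sup>2 \<le> u\<^sup>2 * Y1"
      "(cj (u * c))\<^sup>2 \<le> (cj u)\<^sup>2 * Y2" "(cj (u * d))\<^sup>2 \<le> (cj u)\<^sup>2 * Y2"
      using R \<open>u \<in> R\<close> by (simp_all add: Y1_def Y2_def power_mult_distrib distrib_left)
    then have "\<bar>u * c\<bar> \<le> K" "\<bar>u * d\<bar> \<le> K" "\<bar>cj (u * c)\<bar> \<le> K" "\<bar>cj (u * d)\<bar> \<le> K"
      using B by (auto intro!: root)
    then show ?thesis using u(1) R \<open>u \<in> R\<close> cusps_unit_multiple[OF cd(1) u(1)] unfolding S_def by blast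
  qed
  ultimately show thesis using that[of "cusps \<inter> S \<times> S"] by blast
qed

end

section \<open>Connecting two cusps inside the generated subgroup\<close>

text \<open>The last assumption replaces the matrices chosen in the theorem: some element of \<open>H\<close>
  moves \<open>(0, 1)\<close> to each couple, up to a unit.\<close>

locale neighbour_subgroup = real_quadratic +
  fixes H :: "(real^2^2) set"
  assumes subgroup_H: "subgroup H (SL2 k)"
    and P_in_H: "P1 \<in> H" "P2 k \<in> H" "P3 k \<in> H" "- mat 1 \<in> H"
    and pid: "principal_domain (quad_ring k)"
    and couples_in_H: "\<And>c d. (c, d) \<in> couples k \<Longrightarrow> \<exists>A\<in>H. \<exists>u\<in>Units (quad_ring k). rowmul (0, 1) A = (u * c, u * d)"
begin

lemma H_SL2: "A \<in> H \<Longrightarrow> A \<in> carrier (SL2 k)"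
  using subgroup.subset[OF subgroup_H] by blast

lemma H_mult: "A \<in> H \<Longrightarrow> B \<in> H \<Longrightarrow> A ** B \<in> H"
  using subgroup.m_closed[OF subgroup_H] by fastforce

lemma H_inverse: "A \<in> H \<Longrightarrow> inv\<^bsub>SL2 k\<^esub> A \<in> H"
  using subgroup.m_inv_closed[OF subgroup_H] by fastforce

lemma H_right_inverse: "A \<in> H \<Longrightarrow> A ** B = mat 1 \<Longrightarrow> B \<in> carrier (SL2 k) \<Longrightarrow> B \<in> H"
  using H_inverse[of A] group.inv_equality[OF group_SL2[of k], of A B] group.inv_inv[OF group_SL2[of k], of B] H_SL2[of A]
  by simp

lemma one_mat2: "mat 1 = mat2 1 0 0 1"
  by (simp add: mat2_def mat_def vec_eq_iff forall_2)

definition transl :: "real \<Rightarrow> real^2^2" where "transl \<beta> = mat2 1 \<beta> 0 1"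

lemma transl_in_H:
  assumes "\<beta> \<in> R"
  shows "transl \<beta> \<in> H"
proof -
  have add: "transl (x + y) \<in> H" if "transl x \<in> H" "transl y \<in> H" for x y
    using H_mult[OF that] by (simp add: transl_def mat2_mult add.commute)
  have minus: "transl (- x) \<in> H" if "transl x \<in> H" for x
  proof (rule H_right_inverse[OF that])
    show "transl (- x) \<in> carrier (SL2 k)" using H_SL2[OF that] by (simp add: transl_def mat2_in_SL2)
  qed (simp add: transl_def mat2_mult one_mat2)
  have zero: "transl 0 \<in> H"
    using add[OF minus] P_in_H(1) by (fastforce simp: P1_def transl_def)
  have nat: "transl (of_nat n * x) \<in> H" if "transl x \<in> H" for n x
    using that zero by (induction n) (auto simp: distrib_right intro: add)
  have int: "transl (of_int n * x) \<in> H" if "transl x \<in> H" for n x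
    using nat[OF that] minus by (cases n) (auto simp: minus_mult_left[symmetric] simp del: of_nat_Suc)
  obtain m n where "\<beta> = of_int m * 1 + of_int n * \<omega>" using assms mem_R by auto
  moreover have "transl 1 \<in> H" "transl \<omega> \<in> H" using P_in_H by (simp_all add: P1_def P2_def transl_def)
  ultimately show ?thesis using add int by metis
qed

definition dilat :: "real \<Rightarrow> real^2^2" where "dilat u = mat2 u 0 0 (inverse u)"

lemma dilat_in_H:
  assumes "u \<in> Units (quad_ring k)"
  shows "dilat u \<in> H"
proof -
  have mult: "dilat (x * y) \<in> H" if "dilat x \<in> H" "dilat y \<in> H" for x y
    using H_mult[OF that] by (simp add: dilat_def mat2_mult mult.commute)
  have inverse: "dilat (inverse x) \<in> H" if "dilat x \<in> H" "x \<noteq> 0" for x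
  proof (rule H_right_inverse[OF that(1)])
    show "dilat (inverse x) \<in> carrier (SL2 k)" using H_SL2[OF that(1)] by (auto simp: dilat_def mat2_in_SL2 mult.commute)
  qed (use that in \<open>simp add: dilat_def mat2_mult one_mat2\<close>)
  have "dilat eps \<in> H" using P_in_H by (simp add: P3_def dilat_def)
  have "- mat 1 = dilat (- 1)" by (simp add: one_mat2 dilat_def mat2_def vec_eq_iff forall_2)
  then have m1: "dilat (- 1) \<in> H" using P_in_H by simp
  have one: "dilat 1 \<in> H" using mult[OF m1 m1] by simp
  have pow: "dilat (eps ^ n) \<in> H" for n
    using \<open>dilat eps \<in> H\<close> one by (induction n) (auto intro: mult)
  have "eps ^ n \<noteq> 0" for n using fund_unit_props(2) by simp
  then have "dilat \<bar>u\<bar> \<in> H"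
    using units_are_powers[OF assms] pow inverse by metis
  then show ?thesis using mult[OF m1, of "\<bar>u\<bar>"] by (cases "0 \<le> u") auto
qed

definition orb :: "(real \<times> real) set" where "orb = rowmul (0, 1) ` H"

lemma orb_0_1: "(0, 1) \<in> orb"
  unfolding orb_def using subgroup.one_closed[OF subgroup_H] by (intro image_eqI[of _ _ "mat 1"]) auto

lemma orb_rowmul: "v \<in> orb \<Longrightarrow> A \<in> H \<Longrightarrow> rowmul v A \<in> orb"
  unfolding orb_def by (auto simp: rowmul_mult intro: H_mult)

lemma orb_rowmul_cancel:
  assumes "rowmul v A \<in> orb" "A \<in> H"
  shows "v \<in> orb"
  using orb_rowmul[OF assms(1) H_inverse[OF assms(2)]] SL2_inverse(2)[OF H_SL2[OF assms(2)]]
  by (simp add: rowmul_mult)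

lemma orb_unit_multiple:
  assumes "(u * c, u * d) \<in> orb" "u \<in> Units (quad_ring k)"
  shows "(c, d) \<in> orb"
proof -
  obtain A where A: "A \<in> H" "(u * c, u * d) = rowmul (0, 1) A" using assms(1) by (auto simp: orb_def)
  have "rowmul (0, 1) (dilat u ** A) = (c, d)"
    using A(2) unit_nonzero[OF assms(2)] by (simp add: rowmul_mult[symmetric] dilat_def) (auto simp: rowmul_def field_simps)
  then show ?thesis unfolding orb_def
    using H_mult[OF dilat_in_H[OF assms(2)] A(1)] by (metis image_eqI)
qed

text \<open>The core of the argument: if \<open>(c, d)\<close> is tied with \<open>(0, 1)\<close>, a dilatation and a
  translation in \<open>H\<close> turn it into one of the couples. If \<open>c = 0\<close>, then \<open>d\<close> is a unit.\<close>

lemma minimal_neighbour_in_orb: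
  assumes fg: "posdef f" "posdef g" and m0: "minimal f g (0, 1)" and mw: "minimal f g (c, d)"
  shows "(c, d) \<in> orb"
proof -
  have w: "(c, d) \<in> cusps" using mw by (simp add: minimal_def)
  then have R: "c \<in> R" "d \<in> R" by (simp_all add: cusps_iff)
  show ?thesis
  proof (cases "c = 0")
    case True
    then have "d \<in> Units (quad_ring k)" using w by (auto simp: cusps_iff Units_iff mult.commute)
    then have "inverse d \<in> Units (quad_ring k)" "d \<noteq> 0" using unit_inverse unit_nonzero by auto
    then show ?thesis using orb_unit_multiple[of "inverse d" c d] orb_0_1 True by simp
  next
    case False
    obtain x1 y1 where f: "0 < y1" "\<And>c d. f c d = f 0 1 * cocycle_sq x1 y1 c d" by (rule posdef_point[OF fg(1)]) (rule that)
    obtain x2 y2 where g: "0 < y2" "\<And>c d. g c d = g 0 1 * cocycle_sq x2 y2 c d" by (rule posdef_point[OF fg(2)]) (rule that)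
    define m where "m = f 0 1 * g 0 1"
    have "0 < m" using posdef_pos[OF fg(1), of 0 1] posdef_pos[OF fg(2), of 0 1] by (simp add: m_def)
    have cusp_norm: "cusp_norm f g (c, d) = m * (cocycle_sq x1 y1 c d * cocycle_sq x2 y2 (cj c) (cj d))" for c d
      unfolding cusp_norm_def m_def fst_conv snd_conv by (subst f(2), subst g(2)) simp
    have norm_0_1: "cusp_norm f g (0, 1) = m" by (simp add: cusp_norm_def m_def)
    have one_le: "1 \<le> cocycle_sq x1 y1 c d * cocycle_sq x2 y2 (cj c) (cj d)" if "(c, d) \<in> cusps" for c d
    proof -
      have "m * 1 \<le> m * (cocycle_sq x1 y1 c d * cocycle_sq x2 y2 (cj c) (cj d))"
        using m0 that norm_0_1 unfolding minimal_def by (metis cusp_norm mult_1_right)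
      then show ?thesis using \<open>0 < m\<close> by simp
    qed
    (* Minimality concerns cusps only; a common factor h enters with the square of its
       norm, which is at least 1. *)
    have "cusp_highest x1 y1 x2 y2" unfolding cusp_highest_def
    proof (intro conjI ballI impI f(1) g(1))
      fix c d assume "c \<in> R" "d \<in> R" "(c, d) \<noteq> (0, 0)"
      then obtain h c0 d0 where h: "h \<in> R" "h \<noteq> 0" "(c0, d0) \<in> cusps" "c = h * c0" "d = h * d0"
        using multiple_of_cusp[OF pid] by blast
      have R0: "c0 \<in> R" "d0 \<in> R" using h(3) by (simp_all add: cusps_iff)
      have scale: "cocycle_sq x y (u * c) (u * d) = u\<^sup>2 * cocycle_sq x y c d" for x y u c d
        by (simp add: cocycle_sq_def power2_eq_square algebra_simps)
      have "cocycle_sq x1 y1 c d * cocycle_sq x2 y2 (cj c) (cj d)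
         = (h * cj h)\<^sup>2 * (cocycle_sq x1 y1 c0 d0 * cocycle_sq x2 y2 (cj c0) (cj d0))"
        using h(1) R0 by (simp add: h(4,5) scale power_mult_distrib)
      moreover have "1 \<le> (h * cj h)\<^sup>2" using norm_ge_1[OF h(1,2)] by (simp add: abs_le_square_iff[of 1, simplified])
      ultimately show "1 \<le> cocycle_sq x1 y1 c d * cocycle_sq x2 y2 (cj c) (cj d)"
        using one_le[OF h(3)] mult_mono[of 1 "(h * cj h)\<^sup>2" 1 "cocycle_sq x1 y1 c0 d0 * cocycle_sq x2 y2 (cj c0) (cj d0)"] by simp
    qed
    moreover have "cocycle_sq x1 y1 c d * cocycle_sq x2 y2 (cj c) (cj d) \<le> 1"
    proof -
      have "m * (cocycle_sq x1 y1 c d * cocycle_sq x2 y2 (cj c) (cj d)) \<le> m * 1"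
        using mw cusps_0_1 norm_0_1 cusp_norm unfolding minimal_def by (metis mult_1_right)
      then show ?thesis using \<open>0 < m\<close> by simp
    qed
    ultimately obtain u \<beta> where u: "u \<in> Units (quad_ring k)" "\<beta> \<in> R"
      "\<bar>quad_norm k (c * inverse u)\<bar> \<le> 2 * of_int k / (k0 k)\<^sup>2"
      "\<bar>(d * u - c * inverse u * \<beta>) / (c * inverse u)\<bar> < eps * bound_sqrt k (c * inverse u) + (1 + \<omega>) / 2"
      "\<bar>cj (d * u - c * inverse u * \<beta>) / cj (c * inverse u)\<bar> < eps * bound_sqrt k (c * inverse u) + (1 - cj \<omega>) / 2"
      using neighbour_bounds R False by blast
    define c' d' where "c' = c * inverse u" and "d' = d * u - c * inverse u * \<beta>"
    have d': "d' = d * u - c' * \<beta>" by (simp add: c'_def d'_def)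
    define A where "A = dilat (inverse u) ** transl (- \<beta>)"
    have "A \<in> H" unfolding A_def
      using H_mult[OF dilat_in_H[OF unit_inverse(1)[OF u(1)]] transl_in_H[of "- \<beta>"]] u(2) by simp
    have row: "rowmul (c, d) A = (c', d')"
      by (simp add: A_def rowmul_mult[symmetric] dilat_def transl_def c'_def d'_def)
    have cusp': "(c', d') \<in> cusps" using cusps_rowmul[OF w H_SL2[OF \<open>A \<in> H\<close>]] row by simp
    have "c' \<noteq> 0" using False unit_nonzero[OF u(1)] by (simp add: c'_def)
    then have "(c', d') \<in> couples k"
      using u(3-5)[folded c'_def, folded d'] cusps_imp_ideal_sum[OF cusp'] cusp' unfolding couples_def cusps_iff
      by simp
    then obtain B v where "B \<in> H" "v \<in> Units (quad_ring k)" "rowmul (0, 1) B = (v * c', v * d')"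
      using couples_in_H by blast
    then have "(c', d') \<in> orb" using orb_unit_multiple[of v c' d'] unfolding orb_def by (metis image_eqI)
    then show ?thesis using orb_rowmul_cancel \<open>A \<in> H\<close> row by metis
  qed
qed

text \<open>Substituting a matrix of \<open>H\<close> into the forms moves \<open>v\<close> to \<open>(0, 1)\<close>.\<close>

lemma orb_closed_under_common_minimum:
  assumes fg: "posdef f" "posdef g" and v: "v \<in> orb" "minimal f g v" and w: "minimal f g w"
  shows "w \<in> orb"
proof -
  obtain B where B: "B \<in> H" "v = rowmul (0, 1) B" using v(1) by (auto simp: orb_def)
  note BS = H_SL2[OF B(1)]
  let ?f = "subst_form f B" and ?g = "subst_form g (conj_mat B)" and ?w = "rowmul w (inv\<^bsub>SL2 k\<^esub> B)"
  have pos: "posdef ?f" "posdef ?g"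
    using posdef_subst fg SL2_entries(2)[OF BS] det_conj_mat[OF BS] by auto
  have w': "?w \<in> cusps" "rowmul ?w B = w"
    using w cusps_rowmul[OF _ SL2_inverse(1)[OF BS]] SL2_inverse(3)[OF BS] by (auto simp: minimal_def rowmul_mult)
  have "minimal ?f ?g (0, 1)" using minimal_subst[OF BS cusps_0_1] v(2) B(2) by simp
  moreover have "minimal ?f ?g ?w" using minimal_subst[OF BS w'(1)] w w'(2) by simp
  ultimately have "?w \<in> orb" using minimal_neighbour_in_orb[OF pos] by (metis surj_pair)
  then show ?thesis using orb_rowmul[OF _ B(1)] w'(2) by metis
qed

text \<open>The connectedness argument. The segment of form pairs starts at a pair for which
  \<open>(0, 1)\<close> is minimal and ends at its translate, for which \<open>v\<close> is minimal.\<close>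

lemma bottom_row_in_orb:
  assumes A: "A \<in> carrier (SL2 k)"
  shows "rowmul (0, 1) A \<in> orb"
proof (rule ccontr)
  define v where "v = rowmul (0, 1) A"
  assume "rowmul (0, 1) A \<notin> orb"
  then have v: "v \<notin> orb" "v \<in> cusps" using A by (auto simp: v_def cusps_def)
  define B where "B = inv\<^bsub>SL2 k\<^esub> A"
  have B: "B \<in> carrier (SL2 k)" "rowmul v B = (0, 1)"
    using SL2_inverse[OF A] by (auto simp: B_def v_def rowmul_mult)
  define f0 where "f0 = (\<lambda>c d :: real. c\<^sup>2 + d\<^sup>2)"
  define f1 g1 where "f1 = subst_form f0 B" and "g1 = subst_form f0 (conj_mat B)"
  have pd: "posdef f0" "posdef f1" "posdef g1"
    using posdef_sum_squares posdef_subst SL2_entries(2)[OF B(1)] det_conj_mat[OF B(1)] by (auto simp: f0_def f1_def g1_def)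
  define F G where "F = (\<lambda>s c d. (1 - s) * f0 c d + s * f1 c d)" and "G = (\<lambda>s c d. (1 - s) * f0 c d + s * g1 c d)"
  have pdFG: "posdef (F s)" "posdef (G s)" if "s \<in> {0..1}" for s
    using posdef_convex pd that by (auto simp: F_def G_def)
  have start: "minimal (F 0) (G 0) (0, 1)" using minimal_sum_squares by (simp add: F_def G_def f0_def)
  have "minimal f1 g1 v" unfolding f1_def g1_def
    by (rule minimal_subst[OF B(1) v(2)]) (use B(2) minimal_sum_squares in \<open>simp add: f0_def\<close>)
  then have finish: "minimal (F 1) (G 1) v" by (simp add: F_def G_def)
  obtain \<kappa>1 where \<kappa>1: "0 < \<kappa>1" "\<And>c d. \<kappa>1 * (c\<^sup>2 + d\<^sup>2) \<le> f1 c d" by (rule posdef_lower_bound[OF pd(2)]) (rule that)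
  obtain \<kappa>2 where \<kappa>2: "0 < \<kappa>2" "\<And>c d. \<kappa>2 * (c\<^sup>2 + d\<^sup>2) \<le> g1 c d" by (rule posdef_lower_bound[OF pd(3)]) (rule that)
  (* All forms on the segment are bounded below by one multiple of the sum of squares, and
     the norm of (0, 1) is bounded above, so one finite set of cusps contains a minimal one
     throughout. *)
  define \<kappa> where "\<kappa> = min 1 (min \<kappa>1 \<kappa>2)"
  have "0 < \<kappa>" using \<kappa>1 \<kappa>2 by (simp add: \<kappa>_def)
  have mix: "\<kappa> * (c\<^sup>2 + d\<^sup>2) \<le> (1 - s) * f0 c d + s * h c d"
    if "s \<in> {0..1}" "\<kappa>' * (c\<^sup>2 + d\<^sup>2) \<le> h c d" "\<kappa> \<le> \<kappa>'" for s c d h \<kappa>'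
  proof -
    have "\<kappa> * (c\<^sup>2 + d\<^sup>2) \<le> 1 * (c\<^sup>2 + d\<^sup>2)" "\<kappa> * (c\<^sup>2 + d\<^sup>2) \<le> \<kappa>' * (c\<^sup>2 + d\<^sup>2)"
      using that(3) by (intro mult_right_mono; simp add: \<kappa>_def)+
    then have "\<kappa> * (c\<^sup>2 + d\<^sup>2) \<le> f0 c d" "\<kappa> * (c\<^sup>2 + d\<^sup>2) \<le> h c d" using that(2) by (auto simp: f0_def)
    then have "(1 - s) * (\<kappa> * (c\<^sup>2 + d\<^sup>2)) + s * (\<kappa> * (c\<^sup>2 + d\<^sup>2)) \<le> (1 - s) * f0 c d + s * h c d"
      using that(1) by (intro add_mono mult_left_mono) auto
    then show ?thesis by (simp add: algebra_simps)
  qed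
  have lower: "\<kappa>\<^sup>2 * ((c\<^sup>2 + d\<^sup>2) * ((cj c)\<^sup>2 + (cj d)\<^sup>2)) \<le> cusp_norm (F s) (G s) (c, d)" if "s \<in> {0..1}" for s c d
  proof -
    have F: "\<kappa> * (c\<^sup>2 + d\<^sup>2) \<le> F s c d"
      unfolding F_def by (rule mix[OF that \<kappa>1(2)]) (simp add: \<kappa>_def)
    have G: "\<kappa> * ((cj c)\<^sup>2 + (cj d)\<^sup>2) \<le> G s (cj c) (cj d)"
      unfolding G_def by (rule mix[OF that \<kappa>2(2)]) (simp add: \<kappa>_def)
    have "(\<kappa> * (c\<^sup>2 + d\<^sup>2)) * (\<kappa> * ((cj c)\<^sup>2 + (cj d)\<^sup>2)) \<le> F s c d * G s (cj c) (cj d)"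
      using F G \<open>0 < \<kappa>\<close> posdef_nonneg[OF pdFG(1)[OF that]] by (intro mult_mono) auto
    then show ?thesis by (simp add: cusp_norm_def power2_eq_square algebra_simps)
  qed
  define C0 where "C0 = (1 + f1 0 1) * (1 + g1 0 1)"
  have upper: "cusp_norm (F s) (G s) (0, 1) \<le> C0" if "s \<in> {0..1}" for s
  proof -
    have pos: "0 \<le> f1 0 1" "0 \<le> g1 0 1" using pd posdef_nonneg by auto
    have le: "(1 - s) + s * t \<le> 1 + t" if "0 \<le> t" for t
      using that \<open>s \<in> {0..1}\<close> mult_right_mono[of s 1 t] by auto
    show ?thesis unfolding cusp_norm_def C0_def F_def G_def f0_def using pos \<open>s \<in> {0..1}\<close> le
      by (auto intro!: mult_mono)
  qed
  obtain \<Phi>0 where \<Phi>0: "finite \<Phi>0" "\<Phi>0 \<subseteq> cusps"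
    "\<And>c d. (c, d) \<in> cusps \<Longrightarrow> (c\<^sup>2 + d\<^sup>2) * ((cj c)\<^sup>2 + (cj d)\<^sup>2) \<le> C0 / \<kappa>\<^sup>2 \<Longrightarrow> \<exists>u\<in>Units (quad_ring k). (u * c, u * d) \<in> \<Phi>0"
    by (rule finite_bounded_cusps_mod_units[of "C0 / \<kappa>\<^sup>2"]) (rule that)
  define \<Phi> where "\<Phi> = insert (0, 1) (insert v \<Phi>0)"
  have \<Phi>: "finite \<Phi>" "\<Phi> \<subseteq> cusps" "(0, 1) \<in> \<Phi>" "v \<in> \<Phi>" using \<Phi>0 v(2) cusps_0_1 by (auto simp: \<Phi>_def)
  have attained: "\<exists>\<phi>\<in>\<Phi>. minimal (F s) (G s) \<phi>" if s: "s \<in> {0..1}" for s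
  proof -
    obtain \<phi> where \<phi>: "\<phi> \<in> \<Phi>" "\<And>w. w \<in> \<Phi> \<Longrightarrow> cusp_norm (F s) (G s) \<phi> \<le> cusp_norm (F s) (G s) w"
      using ex_is_arg_min_if_finite[OF \<Phi>(1), of "cusp_norm (F s) (G s)"] \<Phi>(3) unfolding is_arg_min_linorder by blast
    have "cusp_norm (F s) (G s) \<phi> \<le> cusp_norm (F s) (G s) w" if "w \<in> cusps" for w
    proof -
      obtain c d where w: "w = (c, d)" "c \<in> R" "d \<in> R" using \<open>w \<in> cusps\<close> cusps_iff by (metis surj_pair)
      show ?thesis
      proof (cases "(c\<^sup>2 + d\<^sup>2) * ((cj c)\<^sup>2 + (cj d)\<^sup>2) \<le> C0 / \<kappa>\<^sup>2")
        case True
        then obtain u where "u \<in> Units (quad_ring k)" "(u * c, u * d) \<in> \<Phi>"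
          using \<Phi>0(3) \<open>w \<in> cusps\<close> w by (auto simp: \<Phi>_def)
        then show ?thesis using \<phi>(2) cusp_norm_unit_multiple[OF pdFG[OF s]] w by metis
      next
        case False
        then have "C0 \<le> \<kappa>\<^sup>2 * ((c\<^sup>2 + d\<^sup>2) * ((cj c)\<^sup>2 + (cj d)\<^sup>2))" using \<open>0 < \<kappa>\<close> by (simp add: field_simps)
        then show ?thesis unfolding w(1) using lower[OF s, of c d] upper[OF s] \<phi>(2)[OF \<Phi>(3)] by linarith
      qed
    qed
    then show ?thesis using \<phi>(1) \<Phi>(2) unfolding minimal_def by blast
  qed
  define T where "T = (\<lambda>\<phi>. {s \<in> {0..1}. minimal (F s) (G s) \<phi>})"
  have closed: "closed (T \<phi>)" if "\<phi> \<in> \<Phi>" for \<phi>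
  proof -
    have T: "T \<phi> = {0..1} \<inter> (\<Inter>w\<in>cusps. {s. cusp_norm (F s) (G s) \<phi> \<le> cusp_norm (F s) (G s) w})"
      using that \<Phi>(2) by (auto simp: T_def minimal_def)
    have "closed {s. cusp_norm (F s) (G s) \<phi> \<le> cusp_norm (F s) (G s) w}" for w
      unfolding cusp_norm_def F_def G_def by (intro closed_Collect_le continuous_intros)
    then show ?thesis unfolding T by (intro closed_Int closed_INT ballI closed_atLeastAtMost)
  qed
  define T0 T1 where "T0 = (\<Union>\<phi>\<in>\<Phi> \<inter> orb. T \<phi>)" and "T1 = (\<Union>\<phi>\<in>\<Phi> - orb. T \<phi>)"
  have "closed T0" "closed T1" unfolding T0_def T1_def using closed \<Phi>(1) by (auto intro!: closed_UN)
  moreover have "{0..1} \<subseteq> T0 \<union> T1" using attained by (fastforce simp: T0_def T1_def T_def)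
  moreover have "0 \<in> T0 \<inter> {0..1}" using start \<Phi>(3) orb_0_1 by (auto simp: T0_def T_def)
  moreover have "1 \<in> T1 \<inter> {0..1}" using finish \<Phi>(4) v(1) by (auto simp: T1_def T_def)
  ultimately have "T0 \<inter> T1 \<inter> {0..1} \<noteq> {}"
    using connected_Icc[of 0 "1::real"] unfolding connected_closed by blast
  then obtain s \<phi> \<psi> where "s \<in> {0..1}" "\<phi> \<in> orb" "\<psi> \<notin> orb" "minimal (F s) (G s) \<phi>" "minimal (F s) (G s) \<psi>"
    unfolding T0_def T1_def T_def by blast
  then show False using orb_closed_under_common_minimum[OF pdFG] by blast
qed

text \<open>Two matrices with the same bottom row differ by a translation on the left.\<close>

theorem H_eq_SL2: "H = carrier (SL2 k)"
proof
  show "carrier (SL2 k) \<subseteq> H"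
  proof
    fix A assume A: "A \<in> carrier (SL2 k)"
    obtain B where B: "B \<in> H" "rowmul (0, 1) A = rowmul (0, 1) B"
      using bottom_row_in_orb[OF A] by (auto simp: orb_def)
    note inv = SL2_inverse[OF H_SL2[OF B(1)]]
    define C where "C = A ** inv\<^bsub>SL2 k\<^esub> B"
    have C: "C \<in> carrier (SL2 k)" using A inv by (simp add: C_def SL2_mult_closed)
    have "rowmul (0, 1) C = (0, 1)" using B(2) inv(2) by (simp add: C_def rowmul_mult[symmetric]) (simp add: rowmul_mult)
    then have "C $ 2 $ 1 = 0" "C $ 2 $ 2 = 1" by (simp_all add: rowmul_def)
    moreover have "C $ 1 $ 1 = 1" using SL2_entries(2)[OF C] calculation by (simp add: det_2)
    ultimately have "C = transl (C $ 1 $ 2)" using mat2_collapse[of C] by (simp add: transl_def)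
    then have "C \<in> H" using transl_in_H[OF SL2_entries(1)[OF C]] by metis
    moreover have "C ** B = A" using inv(3) by (simp add: C_def matrix_mul_assoc[symmetric])
    ultimately show "A \<in> H" using H_mult B(1) by metis
  qed
qed (use H_SL2 in blast)

end

section \<open>Generators of the Hilbert modular group\<close>

context real_quadratic
begin

lemma generators_in_SL2: "P1 \<in> carrier (SL2 k)" "P2 k \<in> carrier (SL2 k)" "P3 k \<in> carrier (SL2 k)" "- mat 1 \<in> carrier (SL2 k)"
proof -
  show "P3 k \<in> carrier (SL2 k)"
    using unit_inverse[OF fund_unit_props(1)] unit_nonzero[OF fund_unit_props(1)] by (simp add: P3_def mat2_in_SL2)
  have "- mat 1 = mat2 (- 1) 0 0 (- 1)" by (simp add: mat2_def mat_def vec_eq_iff forall_2)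
  then show "- mat 1 \<in> carrier (SL2 k)" by (simp add: mat2_in_SL2)
qed (simp_all add: P1_def P2_def mat2_in_SL2)

text \<open>Passing to the preimage turns generation of \<open>PSL2 k\<close> into a statement about a subgroup
  of \<open>SL2 k\<close> that contains \<open>-1\<close>.\<close>

lemma subgroup_preimage:
  assumes "subgroup G (PSL2 k)"
  shows "subgroup {A \<in> carrier (SL2 k). PSL2_class k A \<in> G} (SL2 k)"
proof -
  interpret N: normal "{mat 1, - mat 1}" "SL2 k" by (rule normal_center)
  interpret Q: group "PSL2 k" unfolding PSL2_def by (rule N.factorgroup_is_group)
  interpret hom: group_hom "SL2 k" "PSL2 k" "PSL2_class k"
    by unfold_locales (use N.r_coset_hom_Mod in \<open>simp add: PSL2_def PSL2_class_def[abs_def]\<close>)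
  show ?thesis
  proof (rule N.subgroupI)
    show "{A \<in> carrier (SL2 k). PSL2_class k A \<in> G} \<noteq> {}"
      using subgroup.one_closed[OF assms] hom.hom_one N.one_closed by force
  next
    fix A assume "A \<in> {A \<in> carrier (SL2 k). PSL2_class k A \<in> G}"
    then show "inv\<^bsub>SL2 k\<^esub> A \<in> {A \<in> carrier (SL2 k). PSL2_class k A \<in> G}"
      using subgroup.m_inv_closed[OF assms] hom.hom_inv by force
  next
    fix A B assume "A \<in> {A \<in> carrier (SL2 k). PSL2_class k A \<in> G}" "B \<in> {A \<in> carrier (SL2 k). PSL2_class k A \<in> G}"
    then show "A \<otimes>\<^bsub>SL2 k\<^esub> B \<in> {A \<in> carrier (SL2 k). PSL2_class k A \<in> G}"
      using subgroup.m_closed[OF assms] hom.hom_mult N.m_closed by force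
  qed auto
qed

end

theorem corollary5p8:
  fixes k :: int
    and S1 :: "(real \<times> real) set"
    and a b :: "real \<times> real \<Rightarrow> real"
  assumes "k > 1" and "squarefree k"
    and "principal_domain (quad_ring k)"
    and "representatives_up_to_units k (couples k) S1"
    and "\<And>c d. (c, d) \<in> S1 \<Longrightarrow>
           mat2 (a (c, d)) (b (c, d)) c d \<in> carrier (SL2 k)"
  shows "carrier (PSL2 k) =
           generate (PSL2 k)
             ({PSL2_class k P1, PSL2_class k (P2 k), PSL2_class k (P3 k)} \<union>
              {PSL2_class k (mat2 (a (c, d)) (b (c, d)) c d) | c d. (c, d) \<in> S1})"
proof -
  interpret real_quadratic k by unfold_locales (fact assms)+
  interpret N: normal "{mat 1, - mat 1}" "SL2 k" by (rule normal_center)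
  interpret Q: group "PSL2 k" unfolding PSL2_def by (rule N.factorgroup_is_group)
  define gens where "gens = {PSL2_class k P1, PSL2_class k (P2 k), PSL2_class k (P3 k)} \<union>
              {PSL2_class k (mat2 (a (c, d)) (b (c, d)) c d) | c d. (c, d) \<in> S1}"
  have carrier: "carrier (PSL2 k) = PSL2_class k ` carrier (SL2 k)"
    by (simp add: PSL2_def PSL2_class_def carrier_FactGroup)
  have gens: "gens \<subseteq> carrier (PSL2 k)"
    unfolding gens_def carrier using generators_in_SL2 assms(5) by blast
  let ?G = "generate (PSL2 k) gens"
  have G: "subgroup ?G (PSL2 k)" by (rule Q.generate_is_subgroup[OF gens])
  define H where "H = {A \<in> carrier (SL2 k). PSL2_class k A \<in> ?G}"
  have in_H: "A \<in> H" if "A \<in> carrier (SL2 k)" "PSL2_class k A \<in> gens" for A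
    using that by (simp add: H_def generate.incl)
  have "PSL2_class k (- mat 1) = \<one>\<^bsub>PSL2 k\<^esub>"
    unfolding PSL2_class_def PSL2_def one_FactGroup
    by (rule N.rcos_const) simp_all
  then have minus: "- mat 1 \<in> H"
    using generators_in_SL2(4) subgroup.one_closed[OF G] by (simp add: H_def)
  interpret neighbour_subgroup k H
  proof (intro neighbour_subgroup.intro neighbour_subgroup_axioms.intro real_quadratic_axioms)
    show "subgroup H (SL2 k)" unfolding H_def by (rule subgroup_preimage[OF G])
    show "P1 \<in> H" "P2 k \<in> H" "P3 k \<in> H"
      using generators_in_SL2 by (auto intro!: in_H simp: gens_def)
    show "principal_domain (quad_ring k)" by fact
    fix c d assume "(c, d) \<in> couples k"
    then obtain s u where s: "s \<in> S1" "u \<in> Units (quad_ring k)" "s = (u * c, u * d)"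
      using assms(4) unfolding representatives_up_to_units_def by blast
    let ?A = "mat2 (a s) (b s) (u * c) (u * d)"
    have "?A \<in> H" using s assms(5) by (intro in_H) (auto simp: gens_def)
    moreover have "rowmul (0, 1) ?A = (u * c, u * d)" by simp
    ultimately show "\<exists>A\<in>H. \<exists>u\<in>Units (quad_ring k). rowmul (0, 1) A = (u * c, u * d)"
      using s(2) by blast
  qed (fact minus)
  have "carrier (PSL2 k) \<subseteq> ?G"
    using H_eq_SL2 unfolding carrier H_def by blast
  then show ?thesis
    using Q.generate_incl[OF gens] unfolding gens_def by blast
qed

end
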